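(* Let $H$, $J$, $A$ and the Dirac operator $D=D_0+D_1+D_R$ be as in the context, and suppose $\delta_{ij}=0$ for all $(i,j)\in\{(1,2),(1,3),(1,4),(2,1),(2,2),(2,3),(2,4)\}$. Then the Hodge property $\mathcal{C}\ell_D(A)'=\mathcal{C}\ell_D(A)^\circ$ holds if and only if both of the following hold: (i) the matrices $\alpha=\begin{bmatrix}\alpha_{13}&\alpha_{14}\\ \alpha_{23}&\alpha_{24}\end{bmatrix}$ and $\beta=\begin{bmatrix}\beta_{13}&\beta_{14}\\ \beta_{23}&\beta_{24}\end{bmatrix}$ have no zero rows; (ii) there are no $\phi,\psi\in\mathbb{R}$ such that $\alpha=\begin{bmatrix}e^{i\phi}&0\\0&e^{i\psi}\end{bmatrix}\beta$.
   Context: Let $H=M_4(\mathbb{C})\oplus M_4(\mathbb{C})$, with elements written as pairs $(v,w)$ and inner product $\langle (v,w),(v',w')\rangle=\mathrm{Tr}(v^*v')+\mathrm{Tr}(w^*w')$. Let $J$ be the antilinear isometry $J(v,w)=(w^*,v^* )$. Identify $\mathrm{End}_{\mathbb{C}}(H)$ with $M_4(\mathbb{C})\otimes M_2(\mathbb{C})\otimes M_4(\mathbb{C})$ via $\big(x\otimes\begin{bmatrix}a&b\\c&d\end{bmatrix}\otimes y\big)(v,w)=\big(x(av+bw)y^t,\ x(cv+dw)y^t\big)$. Here $e_{ij}$ denotes the matrix unit with $1$ in position $(i,j)$ (size clear from context) and $1$ the identity matrix. Let $A\cong\mathbb{C}\oplus\mathbb{H}\oplus M_3(\mathbb{C})$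 be the real $*$-algebra of operators $\mathrm{diag}(\lambda,\bar\lambda,q)\otimes e_{11}\otimes 1+\mathrm{diag}(\lambda,m)\otimes e_{22}\otimes 1$, where $\lambda\in\mathbb{C}$, $q$ is a quaternion viewed as a $2\times 2$ complex matrix $\begin{bmatrix}z&w\\-\bar w&\bar z\end{bmatrix}$, $m\in M_3(\mathbb{C})$, and $\mathrm{diag}$ denotes block-diagonal $4\times4$ matrices. Fix complex parameters $\alpha_{ij},\beta_{ij}$ ($i\in\{1,2\}$, $j\in\{3,4\}$), $\delta_{12},\delta_{13},\delta_{14},\delta_{21},\delta_{22},\delta_{23},\delta_{24}$ and $\Upsilon_R$. Put $\alpha=\begin{bmatrix}\alpha_{13}&\alpha_{14}\\ \alpha_{23}&\alpha_{24}\end{bmatrix}$, $\beta=\begin{bmatrix}\beta_{13}&\beta_{14}\\ \beta_{23}&\beta_{24}\end{bmatrix}$, $X_\alpha=\begin{bmatrix}0&\alpha\\ \alpha^*&0\end{bmatrix}\in M_4(\mathbb{C})$ (in $2\times2$ blocks), $X_\beta$ likewise, and $Y\in M_4(\mathbb{C})$ the matrix with first row $(0,\delta_{12},\delta_{13},\delta_{14})$, second row $(\delta_{21},\delta_{22},\delta_{23},\delta_{24})$ and zero third and fourth rows. Define $D_0=X_\alpha\otimes e_{11}\otimes e_{11}+X_\beta\otimes e_{11}\otimes(1-e_{11})+Y\otimes e_{12}\otimes e_{11}+Y^*\otimes e_{21}\otimes e_{11}$, $D_1=JD_0J^{-1}$, $D_R=e_{11}\otimes(\Upsilon_R e_{21}+\overline{\Upsilon}_R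 e_{12})\otimes e_{11}$, and $D=D_0+D_1+D_R$. For $\xi\in\mathrm{End}_{\mathbb{C}}(H)$ set $\xi^\circ=J\xi^*J^{-1}$, and for a subset $S$ set $S^\circ=\{\xi^\circ:\xi\in S\}$ and $S'=\{\xi\in\mathrm{End}_{\mathbb{C}}(H): [\xi,\eta]=0\ \forall\eta\in S\}$. $\mathcal{C}\ell_D(A)$ is the complex $*$-subalgebra of $\mathrm{End}_{\mathbb{C}}(H)$ generated by $A$ and the operators $a[D,b]$, $a,b\in A$. The Hodge property means $\mathcal{C}\ell_D(A)'=\mathcal{C}\ell_D(A)^\circ$. *)

theory Defs
  imports "Jordan_Normal_Form.Matrix" "HOL.Complex"
begin

(* End_C(H) for H = M4(C) (+) M4(C) is represented by 32x32 complex matrices w.r.t. the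
   orthonormal basis of matrix units; the basis vector of H with (block s, row p, column q)
   (s in {0,1}, p,q in {0..3}, 0-indexed) has index 16*s + 4*p + q. *)

definition blk :: "nat \<Rightarrow> nat" where "blk i = i div 16"
definition rw :: "nat \<Rightarrow> nat" where "rw i = (i mod 16) div 4"
definition cl :: "nat \<Rightarrow> nat" where "cl i = i mod 4"

(* x \<otimes> m \<otimes> y acting by (v,w) |-> (x(av+bw)y^t, x(cv+dw)y^t) *)
definition tensor3 :: "complex mat \<Rightarrow> complex mat \<Rightarrow> complex mat \<Rightarrow> complex mat" where
  "tensor3 x m y = mat 32 32 (\<lambda>(i,j). x $$ (rw i, rw j) * m $$ (blk i, blk j) * y $$ (cl i, cl j))"

(* matrix unit e_{ij} of size n (0-indexed: e11 = eu n 0 0) *)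
definition eu :: "nat \<Rightarrow> nat \<Rightarrow> nat \<Rightarrow> complex mat" where
  "eu n i j = mat n n (\<lambda>(a,b). if a = i \<and> b = j then 1 else 0)"

(* conjugate transpose = Hilbert adjoint w.r.t. the orthonormal matrix-unit basis *)
definition cadj :: "complex mat \<Rightarrow> complex mat" where
  "cadj A = mat (dim_col A) (dim_row A) (\<lambda>(i,j). cnj (A $$ (j,i)))"

(* J(v,w) = (w^H, v^H): (Ju)_i = cnj(u_{Jperm i}) *)
definition Jperm :: "nat \<Rightarrow> nat" where
  "Jperm i = 16 * (1 - blk i) + 4 * cl i + rw i"

definition Jvec :: "complex vec \<Rightarrow> complex vec" where
  "Jvec u = vec 32 (\<lambda>i. cnj (u $ Jperm i))"

(* matrix of the linear operator J \<xi> J^{-1} (note J^{-1} = J) *)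
definition Jconj :: "complex mat \<Rightarrow> complex mat" where
  "Jconj \<xi> = mat 32 32 (\<lambda>(i,j). cnj (\<xi> $$ (Jperm i, Jperm j)))"

definition opp :: "complex mat \<Rightarrow> complex mat" where
  "opp \<xi> = Jconj (cadj \<xi>)"

definition commutant :: "complex mat set \<Rightarrow> complex mat set" where
  "commutant S = {\<xi> \<in> carrier_mat 32 32. \<forall>\<eta>\<in>S. \<xi> * \<eta> = \<eta> * \<xi>}"

inductive_set star_alg :: "complex mat set \<Rightarrow> complex mat set" for S where
  gen: "x \<in> S \<Longrightarrow> x \<in> star_alg S"
| zero: "0\<^sub>m 32 32 \<in> star_alg S"
| add: "x \<in> star_alg S \<Longrightarrow> y \<in> star_alg S \<Longrightarrow> x + y \<in> star_alg S"
| smult: "x \<in> star_alg S \<Longrightarrow> (c::complex) \<cdot>\<^sub>m x \<in> star_alg S"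
| mult: "x \<in> star_alg S \<Longrightarrow> y \<in> star_alg S \<Longrightarrow> x * y \<in> star_alg S"
| cadj: "x \<in> star_alg S \<Longrightarrow> cadj x \<in> star_alg S"

definition diag1 :: "complex \<Rightarrow> complex \<Rightarrow> complex \<Rightarrow> complex mat" where
  "diag1 l z w = mat 4 4 (\<lambda>(i,j).
     if i = 0 \<and> j = 0 then l
     else if i = 1 \<and> j = 1 then cnj l
     else if i = 2 \<and> j = 2 then z
     else if i = 2 \<and> j = 3 then w
     else if i = 3 \<and> j = 2 then - cnj w
     else if i = 3 \<and> j = 3 then cnj z
     else 0)"

definition diag2 :: "complex \<Rightarrow> complex mat \<Rightarrow> complex mat" where
  "diag2 l m = mat 4 4 (\<lambda>(i,j).
     if i = 0 \<and> j = 0 then l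
     else if 1 \<le> i \<and> 1 \<le> j then m $$ (i - 1, j - 1)
     else 0)"

definition algA :: "complex mat set" where
  "algA = {tensor3 (diag1 l z w) (eu 2 0 0) (1\<^sub>m 4) + tensor3 (diag2 l m) (eu 2 1 1) (1\<^sub>m 4)
           | l z w m. m \<in> carrier_mat 3 3}"

definition mat2 :: "complex \<Rightarrow> complex \<Rightarrow> complex \<Rightarrow> complex \<Rightarrow> complex mat" where
  "mat2 a b c d = mat 2 2 (\<lambda>(i,j). if i = 0 then (if j = 0 then a else b) else (if j = 0 then c else d))"

definition Xmat :: "complex mat \<Rightarrow> complex mat" where
  "Xmat a = mat 4 4 (\<lambda>(i,j).
     if i < 2 \<and> 2 \<le> j then a $$ (i, j - 2)
     else if 2 \<le> i \<and> j < 2 then cnj (a $$ (j, i - 2))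
     else 0)"

definition Ymat :: "complex \<Rightarrow> complex \<Rightarrow> complex \<Rightarrow> complex \<Rightarrow> complex \<Rightarrow> complex \<Rightarrow> complex \<Rightarrow> complex mat" where
  "Ymat d12 d13 d14 d21 d22 d23 d24 = mat 4 4 (\<lambda>(i,j).
     if i = 0 then [0, d12, d13, d14] ! j
     else if i = 1 then [d21, d22, d23, d24] ! j
     else 0)"

definition D0 :: "complex mat \<Rightarrow> complex mat \<Rightarrow> complex mat \<Rightarrow> complex mat" where
  "D0 a b Y = tensor3 (Xmat a) (eu 2 0 0) (eu 4 0 0)
            + tensor3 (Xmat b) (eu 2 0 0) (1\<^sub>m 4 - eu 4 0 0)
            + tensor3 Y (eu 2 0 1) (eu 4 0 0)
            + tensor3 (cadj Y) (eu 2 1 0) (eu 4 0 0)"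

definition DR :: "complex \<Rightarrow> complex mat" where
  "DR u = tensor3 (eu 4 0 0) (u \<cdot>\<^sub>m eu 2 1 0 + cnj u \<cdot>\<^sub>m eu 2 0 1) (eu 4 0 0)"

definition Dirac :: "complex mat \<Rightarrow> complex mat \<Rightarrow> complex mat \<Rightarrow> complex \<Rightarrow> complex mat" where
  "Dirac a b Y u = D0 a b Y + Jconj (D0 a b Y) + DR u"

definition CliffD :: "complex mat \<Rightarrow> complex mat set" where
  "CliffD D = star_alg (algA \<union> {a * (D * b - b * D) | a b. a \<in> algA \<and> b \<in> algA})"

definition Hodge :: "complex mat \<Rightarrow> bool" where
  "Hodge D \<longleftrightarrow> commutant (CliffD D) = opp ` CliffD D"

definition no_zero_rows :: "complex mat \<Rightarrow> bool" where
  "no_zero_rows M \<longleftrightarrow> (\<forall>i < dim_row M. \<exists>j < dim_col M. M $$ (i,j) \<noteq> 0)"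

definition diag_phase :: "real \<Rightarrow> real \<Rightarrow> complex mat" where
  "diag_phase \<phi> \<psi> = mat 2 2 (\<lambda>(i,j). if i = j then (if i = 0 then cis \<phi> else cis \<psi>) else 0)"

end

theory Submission
  imports Defs
begin

text \<open>
  Let $e = e_{11}$ act on the right-hand index. With $\delta = 0$ the summands $D_1$ and $D_R$ commute
  with $A$, so only $D_0$ contributes to $\mathcal{C}\ell_D(A)$, which therefore consists of
  block-diagonal operators $f \otimes e_{11} \otimes e + g \otimes e_{11} \otimes (1 - e) +
  h \otimes e_{22} \otimes 1$ with $h \in \mathbb{C} \oplus M_3(\mathbb{C})$. The algebra of all
  such operators has its own opposite as commutant.

  If (i) and (ii) hold, $\mathcal{C}\ell_D(A)$ is this whole algebra: products of the entries of a row
  of $(\alpha, \beta)$ give elements $(s e_{33}, t e_{33})$ of the pair $(f,g)$, and $s = t$ for all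
  of them would force each row of $\alpha$ to be a phase times that of $\beta$. Once $f$ and $g$ are
  decoupled at $e_{33}$, nonzero rows reach all other matrix units.

  If (i) or (ii) fails, a zero row, respectively the diagonal phase matrix, gives a diagonal
  intertwiner $t$ of $X_\alpha$ or $X_\beta$ with itself, respectively of $X_\beta$ with $X_\alpha$.
  The operator moving column $q$ of the first summand to column $q'$ with weights $t$ then
  commutes with $\mathcal{C}\ell_D(A)$ without being in its opposite.
\<close>

subsection \<open>Index arithmetic\<close>

definition idx :: "nat \<Rightarrow> nat \<Rightarrow> nat \<Rightarrow> nat" where
  "idx s p q = 16 * s + 4 * p + q"

lemma idx_simps [simp]:
  assumes "s < 2" "p < 4" "q < 4"
  shows "blk (idx s p q) = s" "rw (idx s p q) = p" "cl (idx s p q) = q" "idx s p q < 32"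
proof -
  have e: "idx s p q mod 16 = 4 * p + q"
    using assms mod_mult_self4[of 16 s "4 * p + q"] by (simp add: idx_def add.assoc)
  show "blk (idx s p q) = s" "idx s p q < 32"
    using assms by (auto simp: blk_def idx_def)
  show "cl (idx s p q) = q" using assms unfolding cl_def idx_def by presburger
  show "rw (idx s p q) = p" using assms e by (simp add: rw_def)
qed

lemma idx_coords [simp]: "idx (blk i) (rw i) (cl i) = i"
proof -
  have "4 * (i mod 16 div 4) + i mod 4 = i mod 16"
    using mult_div_mod_eq[of 4 "i mod 16"] by (simp add: mod_mod_cancel)
  then show ?thesis
    using mult_div_mod_eq[of 16 i] unfolding idx_def blk_def rw_def cl_def by linarith
qed

lemma coords_less [simp]: "i < 32 \<Longrightarrow> blk i < 2" "rw i < 4" "cl i < 4"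
  by (auto simp: blk_def rw_def cl_def)

lemma coords_cong: "blk i = blk j \<Longrightarrow> rw i = rw j \<Longrightarrow> cl i = cl j \<Longrightarrow> i = j"
  by (metis idx_coords)

lemma less_four: "(p::nat) < 4 \<longleftrightarrow> p = 0 \<or> p = 1 \<or> p = 2 \<or> p = 3"
  by auto

lemma less_two: "(p::nat) < 2 \<longleftrightarrow> p = 0 \<or> p = 1"
  by auto

lemma Jperm_idx: "Jperm i = idx (1 - blk i) (cl i) (rw i)"
  by (simp add: Jperm_def idx_def)

lemma Jperm_coords [simp]:
  "blk (Jperm i) = 1 - blk i" "rw (Jperm i) = cl i" "cl (Jperm i) = rw i" "Jperm i < 32"
  by (auto simp: Jperm_idx)

lemma mult_mat_entry:
  assumes "A \<in> carrier_mat n n" "B \<in> carrier_mat n n" "i < n" "j < n"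
  shows "(A * B) $$ (i,j) = (\<Sum>k<n. A $$ (i,k) * B $$ (k,j))"
  using assms by (simp add: scalar_prod_def lessThan_atLeast0)

text \<open>The default rule unfolds an entry of a product into a scalar product of a row and a
  column. Entries are to be computed as sums by \<open>mult_mat_entry\<close>, which can then be
  collapsed.\<close>

declare index_mult_mat(1) [simp del]

text \<open>Block-diagonal operators mix only row indices, so in a matrix product with one of them
  only the four basis vectors with a given summand and column contribute.\<close>

lemma sum_row_fibre:
  fixes F :: "nat \<Rightarrow> complex"
  assumes "s < 2" "q < 4"
    and z: "\<And>k. k < 32 \<Longrightarrow> \<not> (blk k = s \<and> cl k = q) \<Longrightarrow> F k = 0"
  shows "(\<Sum>k<32. F k) = (\<Sum>p<4. F (idx s p q))"
proof -
  have inj: "inj_on (\<lambda>p. idx s p q) {..<4}" by (auto simp: inj_on_def idx_def)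
  have "(\<Sum>k<32. F k) = sum F ((\<lambda>p. idx s p q) ` {..<4})"
  proof (rule sum.mono_neutral_right)
    show "(\<lambda>p. idx s p q) ` {..<4} \<subseteq> {..<32}" using assms by auto
    show "\<forall>k\<in>{..<32} - (\<lambda>p. idx s p q) ` {..<4}. F k = 0"
    proof
      fix k assume k: "k \<in> {..<32} - (\<lambda>p. idx s p q) ` {..<4}"
      have "\<not> (blk k = s \<and> cl k = q)"
        using k by (metis DiffD2 coords_less(2) idx_coords imageI lessThan_iff)
      then show "F k = 0" using z k by auto
    qed
  qed simp
  also have "\<dots> = (\<Sum>p<4. F (idx s p q))" using inj by (simp add: sum.reindex)
  finally show ?thesis .
qed

subsection \<open>Block-diagonal operators\<close>

text \<open>\<open>emb f g h\<close> is $f \otimes e_{11} \otimes e_{11} + g \otimes e_{11} \otimes (1 - e_{11}) +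
  h \otimes e_{22} \otimes 1$, and \<open>slot f g h s q\<close> is its action on column \<open>q\<close> of summand \<open>s\<close>.\<close>

definition slot :: "complex mat \<Rightarrow> complex mat \<Rightarrow> complex mat \<Rightarrow> nat \<Rightarrow> nat \<Rightarrow> complex mat" where
  "slot f g h s q = (if s = 0 then (if q = 0 then f else g) else h)"

definition emb :: "complex mat \<Rightarrow> complex mat \<Rightarrow> complex mat \<Rightarrow> complex mat" where
  "emb f g h = mat 32 32 (\<lambda>(i,j).
     if blk i = blk j \<and> cl i = cl j then slot f g h (blk i) (cl i) $$ (rw i, rw j) else 0)"

lemma emb_carrier [simp]: "emb f g h \<in> carrier_mat 32 32"
  by (simp add: emb_def)

lemma emb_dim [simp]: "dim_row (emb f g h) = 32" "dim_col (emb f g h) = 32"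
  by (auto simp: emb_def)

lemma emb_entry:
  "i < 32 \<Longrightarrow> j < 32 \<Longrightarrow> emb f g h $$ (i,j) =
     (if blk i = blk j \<and> cl i = cl j then slot f g h (blk i) (cl i) $$ (rw i, rw j) else 0)"
  by (simp add: emb_def)

lemma emb_mult_left:
  assumes "T \<in> carrier_mat 32 32" "i < 32" "j < 32"
  shows "(emb f g h * T) $$ (i,j) =
    (\<Sum>p<4. slot f g h (blk i) (cl i) $$ (rw i, p) * T $$ (idx (blk i) p (cl i), j))"
proof -
  have "(emb f g h * T) $$ (i,j) = (\<Sum>k<32. emb f g h $$ (i,k) * T $$ (k,j))"
    by (rule mult_mat_entry) (use assms in auto)
  also have "\<dots> = (\<Sum>p<4. emb f g h $$ (i, idx (blk i) p (cl i)) * T $$ (idx (blk i) p (cl i), j))"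
    by (rule sum_row_fibre) (use assms in \<open>auto simp: emb_entry\<close>)
  finally show ?thesis using assms by (simp add: emb_entry)
qed

lemma emb_mult_right:
  assumes "T \<in> carrier_mat 32 32" "i < 32" "j < 32"
  shows "(T * emb f g h) $$ (i,j) =
    (\<Sum>p<4. T $$ (i, idx (blk j) p (cl j)) * slot f g h (blk j) (cl j) $$ (p, rw j))"
proof -
  have "(T * emb f g h) $$ (i,j) = (\<Sum>k<32. T $$ (i,k) * emb f g h $$ (k,j))"
    by (rule mult_mat_entry) (use assms in auto)
  also have "\<dots> = (\<Sum>p<4. T $$ (i, idx (blk j) p (cl j)) * emb f g h $$ (idx (blk j) p (cl j), j))"
    by (rule sum_row_fibre) (use assms in \<open>auto simp: emb_entry\<close>)
  finally show ?thesis using assms by (simp add: emb_entry)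
qed

lemma emb_mult:
  assumes "f \<in> carrier_mat 4 4" "g \<in> carrier_mat 4 4" "h \<in> carrier_mat 4 4"
    "f' \<in> carrier_mat 4 4" "g' \<in> carrier_mat 4 4" "h' \<in> carrier_mat 4 4"
  shows "emb f g h * emb f' g' h' = emb (f * f') (g * g') (h * h')"
proof (rule eq_matI)
  fix i j assume ij: "i < dim_row (emb (f * f') (g * g') (h * h'))"
    "j < dim_col (emb (f * f') (g * g') (h * h'))"
  then show "(emb f g h * emb f' g' h') $$ (i,j) = emb (f * f') (g * g') (h * h') $$ (i,j)"
    using assms
    by (auto simp: emb_mult_left emb_entry slot_def mult_mat_entry[where n=4])
qed auto

lemma emb_add:
  assumes "f \<in> carrier_mat 4 4" "g \<in> carrier_mat 4 4" "h \<in> carrier_mat 4 4"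
    "f' \<in> carrier_mat 4 4" "g' \<in> carrier_mat 4 4" "h' \<in> carrier_mat 4 4"
  shows "emb f g h + emb f' g' h' = emb (f + f') (g + g') (h + h')"
  by (rule eq_matI) (use assms in \<open>auto simp: emb_entry slot_def\<close>)

lemma emb_smult:
  assumes "f \<in> carrier_mat 4 4" "g \<in> carrier_mat 4 4" "h \<in> carrier_mat 4 4"
  shows "c \<cdot>\<^sub>m emb f g h = emb (c \<cdot>\<^sub>m f) (c \<cdot>\<^sub>m g) (c \<cdot>\<^sub>m h)"
  by (rule eq_matI) (use assms in \<open>auto simp: emb_entry slot_def\<close>)

lemma emb_minus:
  assumes "f \<in> carrier_mat 4 4" "g \<in> carrier_mat 4 4" "h \<in> carrier_mat 4 4"
    "f' \<in> carrier_mat 4 4" "g' \<in> carrier_mat 4 4" "h' \<in> carrier_mat 4 4"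
  shows "emb f g h - emb f' g' h' = emb (f - f') (g - g') (h - h')"
  by (rule eq_matI) (use assms in \<open>auto simp: emb_entry slot_def\<close>)

lemma cadj_entry: "i < dim_col A \<Longrightarrow> j < dim_row A \<Longrightarrow> cadj A $$ (i,j) = cnj (A $$ (j,i))"
  by (simp add: cadj_def)

lemma cadj_dim [simp]: "dim_row (cadj A) = dim_col A" "dim_col (cadj A) = dim_row A"
  by (auto simp: cadj_def)

lemma cadj_carrier [simp]: "A \<in> carrier_mat n m \<Longrightarrow> cadj A \<in> carrier_mat m n"
  by (auto simp: cadj_def)

lemma emb_cadj:
  assumes "f \<in> carrier_mat 4 4" "g \<in> carrier_mat 4 4" "h \<in> carrier_mat 4 4"
  shows "cadj (emb f g h) = emb (cadj f) (cadj g) (cadj h)"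
  by (rule eq_matI) (use assms in \<open>auto simp: emb_entry slot_def cadj_entry\<close>)

lemma emb_zero: "emb (0\<^sub>m 4 4) (0\<^sub>m 4 4) (0\<^sub>m 4 4) = 0\<^sub>m 32 32"
  by (rule eq_matI) (auto simp: emb_entry slot_def)

text \<open>\<open>split1\<close> describes $\mathbb{C} \oplus M_3(\mathbb{C}) \subseteq M_4(\mathbb{C})$.\<close>

definition split1 :: "complex mat \<Rightarrow> bool" where
  "split1 h \<longleftrightarrow> (\<forall>p<4. \<forall>q<4. (p = 0) \<noteq> (q = 0) \<longrightarrow> h $$ (p,q) = 0)"

section \<open>Opposites of block-diagonal operators\<close>

lemma opp_entry:
  "\<xi> \<in> carrier_mat 32 32 \<Longrightarrow> i < 32 \<Longrightarrow> j < 32 \<Longrightarrow> opp \<xi> $$ (i,j) = \<xi> $$ (Jperm j, Jperm i)"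
  by (simp add: opp_def Jconj_def cadj_entry)

lemma opp_carrier [simp]: "opp \<xi> \<in> carrier_mat 32 32"
  by (simp add: opp_def Jconj_def)

text \<open>The conjugations in the adjoint and in \<open>Jconj\<close> cancel, so the opposite is a
  transpose relabelled by \<open>Jperm\<close>. As J exchanges the summands and transposes, the
  opposite acts on column indices, and the row index selects between \<open>f\<close> and
  \<open>g\<close>.\<close>

lemma opp_emb_entry:
  "i < 32 \<Longrightarrow> j < 32 \<Longrightarrow> opp (emb f g h) $$ (i,j) =
    (if blk i = blk j \<and> rw i = rw j then slot f g h (1 - blk i) (rw i) $$ (cl j, cl i) else 0)"
  by (auto simp: opp_entry emb_entry less_two dest!: coords_less(1))

text \<open>One factor acts on rows and the other on columns, so they can disagree only if one
  changes the index by which the other selects its slot. In the first summand \<open>h\<close> moves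
  the column that decides between \<open>f'\<close> and \<open>g'\<close>; in the second
  \<open>h'\<close> moves the row that decides between \<open>f\<close> and \<open>g\<close>. The
  selection only asks whether that index is 0, which \<open>split1\<close> preserves.\<close>

lemma opp_emb_commute:
  assumes h: "split1 h" "split1 h'"
  shows "opp (emb f g h) * emb f' g' h' = emb f' g' h' * opp (emb f g h)"
proof (rule eq_matI)
  fix i j assume "i < dim_row (emb f' g' h' * opp (emb f g h))"
    "j < dim_col (emb f' g' h' * opp (emb f g h))"
  then have ij: "i < 32" "j < 32" by (auto simp: opp_def Jconj_def)
  let ?O = "opp (emb f g h)"
  have 1: "(?O * emb f' g' h') $$ (i,j) =
    (if blk i = blk j then slot f g h (1 - blk i) (rw i) $$ (cl j, cl i)
       * slot f' g' h' (blk j) (cl j) $$ (rw i, rw j) else 0)"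
    using ij by (simp add: emb_mult_right opp_emb_entry if_distrib[of "\<lambda>x. x * _"] cong: if_cong)
  have 2: "(emb f' g' h' * ?O) $$ (i,j) =
    (if blk i = blk j then slot f' g' h' (blk i) (cl i) $$ (rw i, rw j)
       * slot f g h (1 - blk i) (rw j) $$ (cl j, cl i) else 0)"
    using ij by (simp add: emb_mult_left opp_emb_entry if_distrib[of "\<lambda>x. _ * x"] cong: if_cong)
  show "(?O * emb f' g' h') $$ (i,j) = (emb f' g' h' * ?O) $$ (i,j)"
    unfolding 1 2 using h coords_less(1)[OF ij(1)] coords_less(2,3)[of i] coords_less(2,3)[of j]
    by (fastforce simp: slot_def split1_def)
qed (auto simp: opp_def Jconj_def)

section \<open>The algebra A and the operator D in block-diagonal terms\<close>

lemma eu_carrier [simp]: "eu n i j \<in> carrier_mat n n"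
  by (simp add: eu_def)

lemma eu_dim [simp]: "dim_row (eu n i j) = n" "dim_col (eu n i j) = n"
  by (auto simp: eu_def)

lemma eu_entry: "a < n \<Longrightarrow> b < n \<Longrightarrow> eu n i j $$ (a,b) = (if a = i \<and> b = j then 1 else 0)"
  by (simp add: eu_def)

lemma diag1_carrier [simp]: "diag1 l z w \<in> carrier_mat 4 4"
  by (simp add: diag1_def)

lemma diag2_carrier [simp]: "diag2 l m \<in> carrier_mat 4 4"
  by (simp add: diag2_def)

lemma Xmat_carrier [simp]: "Xmat a \<in> carrier_mat 4 4"
  by (simp add: Xmat_def)

lemma split1_diag2: "split1 (diag2 l m)"
  by (auto simp: split1_def diag2_def)

lemma algA_elem_emb:
  "tensor3 (diag1 l z w) (eu 2 0 0) (1\<^sub>m 4) + tensor3 (diag2 l m) (eu 2 1 1) (1\<^sub>m 4)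
     = emb (diag1 l z w) (diag1 l z w) (diag2 l m)"
proof (rule eq_matI, goal_cases)
  case (1 i j)
  then have "i < 32" "j < 32" by auto
  then show ?case
    using coords_less(1)[of i] coords_less(1)[of j]
    by (auto simp: tensor3_def emb_entry slot_def eu_entry less_two)
qed (auto simp: tensor3_def)

lemma algA_emb: "algA = {emb (diag1 l z w) (diag1 l z w) (diag2 l m) | l z w m. m \<in> carrier_mat 3 3}"
  unfolding algA_def algA_elem_emb ..

abbreviation "D00 a b \<equiv> D0 a b (Ymat 0 0 0 0 0 0 0)"

lemma D0_emb: "D00 a b = emb (Xmat a) (Xmat b) (0\<^sub>m 4 4)"
proof (rule eq_matI, goal_cases)
  case (1 i j)
  then have ij: "i < 32" "j < 32" by auto
  have Y: "Ymat 0 0 0 0 0 0 0 = 0\<^sub>m 4 4"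
  proof (rule eq_matI, goal_cases)
    case (1 i j)
    then have "j = 0 \<or> j = 1 \<or> j = 2 \<or> j = 3" by auto
    then show ?case using 1 by (auto simp: Ymat_def)
  qed (auto simp: Ymat_def)
  show ?case unfolding Y
    using ij coords_less(1)[of i] coords_less(1)[of j]
    by (auto simp: D0_def tensor3_def emb_entry slot_def eu_entry less_two cadj_entry)
qed (auto simp: D0_def tensor3_def)

lemma cadj_Xmat: "cadj (Xmat a) = Xmat a"
  by (rule eq_matI) (auto simp: cadj_entry Xmat_def)

text \<open>\<open>D00\<close> is self-adjoint, so D_1 is an opposite and
  \<open>opp_emb_commute\<close> applies to it.\<close>

lemma Jconj_D0: "Jconj (D00 a b) = opp (D00 a b)"
proof -
  have "cadj (0\<^sub>m 4 4) = 0\<^sub>m 4 4" by (rule eq_matI) (auto simp: cadj_entry)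
  then show ?thesis by (simp add: opp_def D0_emb emb_cadj cadj_Xmat)
qed

text \<open>D_R only exchanges the top left entries of the two summands, up to scalars. Elements of
  A act on row 0 of both summands by the same scalar \<open>l\<close>.\<close>

lemma DR_commute:
  assumes b: "b \<in> algA"
  shows "DR u * b = b * DR u"
proof -
  from b obtain l z w m where b: "b = emb (diag1 l z w) (diag1 l z w) (diag2 l m)"
    by (auto simp: algA_emb)
  have car: "DR u \<in> carrier_mat 32 32" by (simp add: DR_def tensor3_def)
  have e: "DR u $$ (i,j) = (if rw i = 0 \<and> rw j = 0 \<and> cl i = 0 \<and> cl j = 0 then
      (u \<cdot>\<^sub>m eu 2 1 0 + cnj u \<cdot>\<^sub>m eu 2 0 1) $$ (blk i, blk j) else 0)" if "i < 32" "j < 32" for i j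
    using that by (auto simp: DR_def tensor3_def eu_entry)
  have s: "(\<Sum>p<4. F p) = F 0 + F 1 + F 2 + F 3" for F :: "nat \<Rightarrow> complex"
    by (simp add: numeral_eq_Suc)
  show ?thesis
  proof (rule eq_matI, goal_cases)
    case (1 i j)
    then have ij: "i < 32" "j < 32" using car b by auto
    show ?case unfolding b using ij car
      by (auto simp: emb_mult_left emb_mult_right s e slot_def diag1_def diag2_def)
  qed (use car b in auto)
qed

lemma Dirac_commutator:
  assumes b: "b \<in> algA"
  shows "Dirac a a' (Ymat 0 0 0 0 0 0 0) u * b - b * Dirac a a' (Ymat 0 0 0 0 0 0 0) u
    = D00 a a' * b - b * D00 a a'"
proof -
  have s0: "split1 (0\<^sub>m 4 4)" by (auto simp: split1_def)
  have J: "Jconj (D00 a a') * b = b * Jconj (D00 a a')"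
    using b opp_emb_commute[OF s0 split1_diag2] unfolding Jconj_D0 by (unfold D0_emb) (auto simp: algA_emb)
  have c0: "D00 a a' \<in> carrier_mat 32 32" by (simp add: D0_emb)
  have cJ: "Jconj (D00 a a') \<in> carrier_mat 32 32" by (simp add: Jconj_def)
  have cR: "DR u \<in> carrier_mat 32 32" by (simp add: DR_def tensor3_def)
  have cb: "b \<in> carrier_mat 32 32" using b by (auto simp: algA_emb)
  have l: "Dirac a a' (Ymat 0 0 0 0 0 0 0) u * b = D00 a a' * b + Jconj (D00 a a') * b + DR u * b"
    unfolding Dirac_def using c0 cJ cR cb by (simp del: assoc_add_mat add: add_mult_distrib_mat[of _ 32 32])
  have r: "b * Dirac a a' (Ymat 0 0 0 0 0 0 0) u = b * D00 a a' + Jconj (D00 a a') * b + DR u * b"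
    unfolding Dirac_def J DR_commute[OF b] using c0 cJ cR cb by (simp del: assoc_add_mat add: mult_add_distrib_mat[where nr=32 and n=32 and nc=32])
  show ?thesis unfolding l r
    by (rule eq_matI) (use c0 cJ cR cb in auto)
qed

section \<open>The algebra generated by A and D_0\<close>

definition cliff :: "complex mat \<Rightarrow> complex mat \<Rightarrow> complex mat set" where
  "cliff a b = star_alg (algA \<union> {x * (D00 a b * y - y * D00 a b) | x y. x \<in> algA \<and> y \<in> algA})"

lemma CliffD_eq: "CliffD (Dirac a b (Ymat 0 0 0 0 0 0 0) u) = cliff a b"
proof -
  have "{x * (Dirac a b (Ymat 0 0 0 0 0 0 0) u * y - y * Dirac a b (Ymat 0 0 0 0 0 0 0) u) | x y. x \<in> algA \<and> y \<in> algA}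
    = {x * (D00 a b * y - y * D00 a b) | x y. x \<in> algA \<and> y \<in> algA}"
    by (intro Collect_cong) (metis Dirac_commutator)
  then show ?thesis by (simp add: CliffD_def cliff_def)
qed


lemma star_alg_least:
  assumes "S \<subseteq> N" "0\<^sub>m 32 32 \<in> N"
    "\<And>x y. x \<in> N \<Longrightarrow> y \<in> N \<Longrightarrow> x + y \<in> N" "\<And>x c. x \<in> N \<Longrightarrow> c \<cdot>\<^sub>m x \<in> N"
    "\<And>x y. x \<in> N \<Longrightarrow> y \<in> N \<Longrightarrow> x * y \<in> N" "\<And>x. x \<in> N \<Longrightarrow> cadj x \<in> N"
  shows "star_alg S \<subseteq> N"
proof
  fix x assume "x \<in> star_alg S"
  then show "x \<in> N" by induction (use assms in blast)+
qed

subsection \<open>Necessity: intertwiners in the commutant\<close>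

text \<open>With T = diag(t), the first equation says T F = G T, and the second says that the
  adjoint of T intertwines in the other direction. Requiring both makes the condition stable under
  adjoints of \<open>F\<close> and \<open>G\<close>.\<close>

definition intertw :: "(nat \<Rightarrow> complex) \<Rightarrow> complex mat \<Rightarrow> complex mat \<Rightarrow> bool" where
  "intertw t F G \<longleftrightarrow> (\<forall>i<4. \<forall>j<4. t i * F $$ (i,j) = t j * G $$ (i,j) \<and>
     cnj (t i) * G $$ (i,j) = cnj (t j) * F $$ (i,j))"

lemma intertw_mult:
  assumes "F \<in> carrier_mat 4 4" "G \<in> carrier_mat 4 4" "F' \<in> carrier_mat 4 4" "G' \<in> carrier_mat 4 4"
    and I: "intertw t F G" "intertw t F' G'"
  shows "intertw t (F * F') (G * G')"
  unfolding intertw_def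
proof (intro allI impI)
  fix i j :: nat assume ij: "i < 4" "j < 4"
  \<comment> \<open>This is T F F' = G T F' = G G' T. As T is diagonal, it holds for each summand of
    the product separately.\<close>
  have slide: "x * (p * q) = z * (p' * q')" if "x * p = y * p'" "y * q = z * q'"
    for x y z p q p' q' :: complex
  proof -
    have "x * (p * q) = (x * p) * q" by (rule mult.assoc[symmetric])
    also have "\<dots> = p' * (y * q)" unfolding that(1) by (simp only: ac_simps)
    also have "\<dots> = z * (p' * q')" unfolding that(2) by (simp only: ac_simps)
    finally show ?thesis .
  qed
  have "t i * (F $$ (i,k) * F' $$ (k,j)) = t j * (G $$ (i,k) * G' $$ (k,j))"
    "cnj (t i) * (G $$ (i,k) * G' $$ (k,j)) = cnj (t j) * (F $$ (i,k) * F' $$ (k,j))"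
    if "k < 4" for k
  proof -
    have 1: "t i * F $$ (i,k) = t k * G $$ (i,k)" "t k * F' $$ (k,j) = t j * G' $$ (k,j)"
      "cnj (t i) * G $$ (i,k) = cnj (t k) * F $$ (i,k)" "cnj (t k) * G' $$ (k,j) = cnj (t j) * F' $$ (k,j)"
      using I that ij unfolding intertw_def by blast+
    show "t i * (F $$ (i,k) * F' $$ (k,j)) = t j * (G $$ (i,k) * G' $$ (k,j))"
      using 1(1,2) by (rule slide)
    show "cnj (t i) * (G $$ (i,k) * G' $$ (k,j)) = cnj (t j) * (F $$ (i,k) * F' $$ (k,j))"
      using 1(3,4) by (rule slide)
  qed
  then show "t i * (F * F') $$ (i,j) = t j * (G * G') $$ (i,j) \<and>
     cnj (t i) * (G * G') $$ (i,j) = cnj (t j) * (F * F') $$ (i,j)"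
    using assms(1-4) ij by (simp add: mult_mat_entry[where n=4] sum_distrib_left)
qed

text \<open>For \<open>t = 0\<close> the intertwining condition is void, which leaves all block-diagonal operators.\<close>

definition intertw_alg :: "(nat \<Rightarrow> complex) \<Rightarrow> nat \<Rightarrow> nat \<Rightarrow> complex mat set" where
  "intertw_alg t q q' = {emb f g h | f g h. f \<in> carrier_mat 4 4 \<and> g \<in> carrier_mat 4 4 \<and> h \<in> carrier_mat 4 4
     \<and> split1 h \<and> intertw t (slot f g h 0 q) (slot f g h 0 q')}"

lemma intertw_alg_emb:
  "f \<in> carrier_mat 4 4 \<Longrightarrow> g \<in> carrier_mat 4 4 \<Longrightarrow> h \<in> carrier_mat 4 4 \<Longrightarrow> split1 h \<Longrightarrow>
    intertw t (slot f g h 0 q) (slot f g h 0 q') \<Longrightarrow> emb f g h \<in> intertw_alg t q q'"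
  unfolding intertw_alg_def by blast

lemma split1_mult:
  assumes "h \<in> carrier_mat 4 4" "h' \<in> carrier_mat 4 4" "split1 h" "split1 h'"
  shows "split1 (h * h')"
  unfolding split1_def
proof (intro allI impI)
  fix p q :: nat assume pq: "p < 4" "q < 4" "(p = 0) \<noteq> (q = 0)"
  have "h $$ (p,k) * h' $$ (k,q) = 0" if "k < 4" for k
  proof (cases "(p = 0) = (k = 0)")
    case True
    then have "h' $$ (k,q) = 0" using assms(4) pq that unfolding split1_def by blast
    then show ?thesis by simp
  next
    case False
    then have "h $$ (p,k) = 0" using assms(3) pq that unfolding split1_def by blast
    then show ?thesis by simp
  qed
  then show "(h * h') $$ (p,q) = 0"
    using assms(1,2) pq by (auto simp: mult_mat_entry[where n=4] intro!: sum.neutral)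
qed

lemma slot_mult: "slot (f * f') (g * g') (h * h') s q = slot f g h s q * slot f' g' h' s q"
  by (simp add: slot_def)

lemma slot_smult: "slot (c \<cdot>\<^sub>m f) (c \<cdot>\<^sub>m g) (c \<cdot>\<^sub>m h) s q = c \<cdot>\<^sub>m slot f g h s q"
  by (simp add: slot_def)

lemma intertw_smult:
  assumes "F \<in> carrier_mat 4 4" "G \<in> carrier_mat 4 4" and I: "intertw t F G"
  shows "intertw t (c \<cdot>\<^sub>m F) (c \<cdot>\<^sub>m G)"
proof -
  have "x * (c * y) = x' * (c * y')" if "x * y = x' * y'" for x y x' y' :: complex
    using that by (metis mult.left_commute)
  then show ?thesis using assms by (simp add: intertw_def)
qed

lemma slot_add: "slot (f + f') (g + g') (h + h') s q = slot f g h s q + slot f' g' h' s q"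
  by (simp add: slot_def)

lemma intertw_add:
  assumes "F \<in> carrier_mat 4 4" "G \<in> carrier_mat 4 4" "F' \<in> carrier_mat 4 4" "G' \<in> carrier_mat 4 4"
    and "intertw t F G" "intertw t F' G'"
  shows "intertw t (F + F') (G + G')"
  using assms by (simp add: intertw_def distrib_left)

lemma slot_carrier:
  "f \<in> carrier_mat n n \<Longrightarrow> g \<in> carrier_mat n n \<Longrightarrow> h \<in> carrier_mat n n \<Longrightarrow> slot f g h s q \<in> carrier_mat n n"
  by (simp add: slot_def)

lemma intertw_alg_mult: "x \<in> intertw_alg t q q' \<Longrightarrow> y \<in> intertw_alg t q q' \<Longrightarrow> x * y \<in> intertw_alg t q q'"
proof -
  assume "x \<in> intertw_alg t q q'" "y \<in> intertw_alg t q q'"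
  then obtain f g h f' g' h' where
    xy: "x = emb f g h" "y = emb f' g' h'"
    and c: "f \<in> carrier_mat 4 4" "g \<in> carrier_mat 4 4" "h \<in> carrier_mat 4 4"
      "f' \<in> carrier_mat 4 4" "g' \<in> carrier_mat 4 4" "h' \<in> carrier_mat 4 4"
    and s: "split1 h" "split1 h'"
    and i: "intertw t (slot f g h 0 q) (slot f g h 0 q')" "intertw t (slot f' g' h' 0 q) (slot f' g' h' 0 q')"
    unfolding intertw_alg_def by blast
  have "split1 (h * h')" using c s by (intro split1_mult)
  moreover have "intertw t (slot (f * f') (g * g') (h * h') 0 q) (slot (f * f') (g * g') (h * h') 0 q')"
    unfolding slot_mult using c i by (intro intertw_mult slot_carrier)
  ultimately show ?thesis
    unfolding xy using c by (simp add: emb_mult intertw_alg_emb)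
qed

lemma intertw_alg_add: "x \<in> intertw_alg t q q' \<Longrightarrow> y \<in> intertw_alg t q q' \<Longrightarrow> x + y \<in> intertw_alg t q q'"
proof -
  assume "x \<in> intertw_alg t q q'" "y \<in> intertw_alg t q q'"
  then obtain f g h f' g' h' where
    xy: "x = emb f g h" "y = emb f' g' h'"
    and c: "f \<in> carrier_mat 4 4" "g \<in> carrier_mat 4 4" "h \<in> carrier_mat 4 4"
      "f' \<in> carrier_mat 4 4" "g' \<in> carrier_mat 4 4" "h' \<in> carrier_mat 4 4"
    and s: "split1 h" "split1 h'"
    and i: "intertw t (slot f g h 0 q) (slot f g h 0 q')" "intertw t (slot f' g' h' 0 q) (slot f' g' h' 0 q')"
    unfolding intertw_alg_def by blast
  have "split1 (h + h')" using c s by (auto simp: split1_def)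
  moreover have "intertw t (slot (f + f') (g + g') (h + h') 0 q) (slot (f + f') (g + g') (h + h') 0 q')"
    unfolding slot_add using c i by (intro intertw_add slot_carrier)
  ultimately show ?thesis
    unfolding xy using c by (simp add: emb_add intertw_alg_emb)
qed

lemma intertw_alg_smult: "x \<in> intertw_alg t q q' \<Longrightarrow> c \<cdot>\<^sub>m x \<in> intertw_alg t q q'"
proof -
  assume "x \<in> intertw_alg t q q'"
  then obtain f g h where
    x: "x = emb f g h"
    and c: "f \<in> carrier_mat 4 4" "g \<in> carrier_mat 4 4" "h \<in> carrier_mat 4 4"
    and s: "split1 h"
    and i: "intertw t (slot f g h 0 q) (slot f g h 0 q')"
    unfolding intertw_alg_def by blast
  have "split1 (c \<cdot>\<^sub>m h)" using c s by (auto simp: split1_def)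
  moreover have "intertw t (slot (c \<cdot>\<^sub>m f) (c \<cdot>\<^sub>m g) (c \<cdot>\<^sub>m h) 0 q) (slot (c \<cdot>\<^sub>m f) (c \<cdot>\<^sub>m g) (c \<cdot>\<^sub>m h) 0 q')"
    unfolding slot_smult using c i by (intro intertw_smult slot_carrier)
  ultimately show ?thesis
    unfolding x using c by (simp add: emb_smult intertw_alg_emb)
qed

lemma slot_cadj: "slot (cadj f) (cadj g) (cadj h) s q = cadj (slot f g h s q)"
  by (simp add: slot_def)

text \<open>Taking adjoints turns each of the two intertwining equations into the other.\<close>

lemma intertw_cadj:
  assumes "F \<in> carrier_mat 4 4" "G \<in> carrier_mat 4 4" "intertw t F G"
  shows "intertw t (cadj F) (cadj G)"
  unfolding intertw_def
proof (intro allI impI)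
  fix i j :: nat assume ij: "i < 4" "j < 4"
  then have "t j * F $$ (j,i) = t i * G $$ (j,i)" "cnj (t j) * G $$ (j,i) = cnj (t i) * F $$ (j,i)"
    using assms(3) by (auto simp: intertw_def)
  then have "cnj (t j * F $$ (j,i)) = cnj (t i * G $$ (j,i))" "cnj (cnj (t j) * G $$ (j,i)) = cnj (cnj (t i) * F $$ (j,i))"
    by simp_all
  then show "t i * cadj F $$ (i,j) = t j * cadj G $$ (i,j) \<and> cnj (t i) * cadj G $$ (i,j) = cnj (t j) * cadj F $$ (i,j)"
    using assms(1,2) ij by (simp add: cadj_entry)
qed

lemma intertw_alg_cadj: "x \<in> intertw_alg t q q' \<Longrightarrow> cadj x \<in> intertw_alg t q q'"
proof -
  assume "x \<in> intertw_alg t q q'"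
  then obtain f g h where
    x: "x = emb f g h"
    and c: "f \<in> carrier_mat 4 4" "g \<in> carrier_mat 4 4" "h \<in> carrier_mat 4 4"
    and s: "split1 h"
    and i: "intertw t (slot f g h 0 q) (slot f g h 0 q')"
    unfolding intertw_alg_def by blast
  have "split1 (cadj h)" using c s by (auto simp: split1_def cadj_entry)
  moreover have "intertw t (slot (cadj f) (cadj g) (cadj h) 0 q) (slot (cadj f) (cadj g) (cadj h) 0 q')"
    unfolding slot_cadj using c i by (intro intertw_cadj slot_carrier)
  ultimately show ?thesis
    unfolding x using c by (simp add: emb_cadj intertw_alg_emb)
qed

lemma intertw_alg_carrier: "x \<in> intertw_alg t q q' \<Longrightarrow> x \<in> carrier_mat 32 32"
  by (auto simp: intertw_alg_def)

lemma intertw_alg_minus: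
  assumes "x \<in> intertw_alg t q q'" "y \<in> intertw_alg t q q'"
  shows "x - y \<in> intertw_alg t q q'"
proof -
  have "x - y = x + (-1) \<cdot>\<^sub>m y"
    by (rule eq_matI) (use assms[THEN intertw_alg_carrier] in auto)
  then show ?thesis using assms by (simp add: intertw_alg_add intertw_alg_smult)
qed

lemma split1_zero: "split1 (0\<^sub>m 4 4)"
  by (auto simp: split1_def)

text \<open>An element of A acts equally on all columns of the first summand, so T only has to
  commute with \<open>diag1\<close>. That matrix is diagonal apart from its quaternion block on rows
  2 and 3, hence the condition \<open>t 2 = t 3\<close>. The hypothesis on \<open>Xmat\<close>
  handles D_0.\<close>

lemma cliff_subset_intertw_alg:
  fixes q q' :: nat
  assumes t: "t 2 = t 3"
    and X: "intertw t (if q = 0 then Xmat a else Xmat b) (if q' = 0 then Xmat a else Xmat b)"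
  shows "cliff a b \<subseteq> intertw_alg t q q'"
proof -
  have D: "D00 a b \<in> intertw_alg t q q'"
    unfolding D0_emb by (rule intertw_alg_emb) (use X in \<open>auto simp: slot_def split1_zero\<close>)
  have "intertw t (diag1 l z w) (diag1 l z w)" for l z w
    using t by (auto simp: intertw_def diag1_def)
  then have A: "algA \<subseteq> intertw_alg t q q'"
    unfolding algA_emb by (auto intro!: intertw_alg_emb simp: split1_diag2 slot_def)
  show ?thesis unfolding cliff_def
  proof (rule star_alg_least)
    show "0\<^sub>m 32 32 \<in> intertw_alg t q q'"
      unfolding emb_zero[symmetric] by (rule intertw_alg_emb) (auto simp: split1_zero intertw_def slot_def)
    show "algA \<union> {x * (D00 a b * y - y * D00 a b) | x y. x \<in> algA \<and> y \<in> algA} \<subseteq> intertw_alg t q q'"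
      using A D by (auto intro!: intertw_alg_mult intertw_alg_minus)
  qed (auto intro: intertw_alg_add intertw_alg_smult intertw_alg_mult intertw_alg_cadj)
qed

text \<open>In tensor notation this is diag(t) (x) e_11 (x) E, where E is the unit with its 1 in row
  \<open>q'\<close> and column \<open>q\<close>, counted from 0.\<close>

definition shift :: "(nat \<Rightarrow> complex) \<Rightarrow> nat \<Rightarrow> nat \<Rightarrow> complex mat" where
  "shift t q q' = mat 32 32 (\<lambda>(i,j).
     if blk i = 0 \<and> blk j = 0 \<and> rw i = rw j \<and> cl i = q' \<and> cl j = q then t (rw i) else 0)"

text \<open>A block-diagonal operator acts on column \<open>q\<close> by one slot F and on column
  \<open>q'\<close> by another slot G, so the commutator reduces to T F - G T.\<close>

lemma shift_commute:
  assumes x: "x \<in> intertw_alg t q q'"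
  shows "shift t q q' * x = x * shift t q q'"
proof -
  obtain f g h where
    x: "x = emb f g h" and i: "intertw t (slot f g h 0 q) (slot f g h 0 q')"
    using x unfolding intertw_alg_def by blast
  have c: "shift t q q' \<in> carrier_mat 32 32" by (simp add: shift_def)
  show ?thesis
  proof (rule eq_matI, goal_cases)
    case (1 i j)
    then have ij: "i < 32" "j < 32" using c x by auto
    have 1: "(shift t q q' * x) $$ (i,j) = (if blk i = 0 \<and> blk j = 0 \<and> cl i = q' \<and> cl j = q
        then t (rw i) * slot f g h 0 q $$ (rw i, rw j) else 0)"
      unfolding x using ij c
      by (auto simp: emb_mult_right shift_def if_distrib[of "\<lambda>x. x * _"] cong: if_cong)
    have 2: "(x * shift t q q') $$ (i,j) = (if blk i = 0 \<and> blk j = 0 \<and> cl i = q' \<and> cl j = q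
        then slot f g h 0 q' $$ (rw i, rw j) * t (rw j) else 0)"
      unfolding x using ij c
      by (auto simp: emb_mult_left shift_def if_distrib[of "\<lambda>x. _ * x"] cong: if_cong)
    show ?case unfolding 1 2 using i by (auto simp: intertw_def mult.commute)
  qed (use c x in auto)
qed

text \<open>The Hodge property makes the shift the opposite of some \<open>emb f g h\<close>. On the
  first summand such an opposite acts through \<open>h\<close> on columns, in the same way for every
  row, so the weights are constant. They vanish when \<open>split1\<close> forbids passing between
  column 0 and the other columns.\<close>

lemma Hodge_shift:
  fixes q q' :: nat
  assumes H: "commutant (cliff a b) = opp ` cliff a b"
    and t: "t 2 = t 3"
    and X: "intertw t (if q = 0 then Xmat a else Xmat b) (if q' = 0 then Xmat a else Xmat b)"
    and q: "q < 4" "q' < 4" and p: "p < 4"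
  shows "t p = t 2" "(q = 0) \<noteq> (q' = 0) \<Longrightarrow> t p = 0"
proof -
  have sub: "cliff a b \<subseteq> intertw_alg t q q'" using t X by (rule cliff_subset_intertw_alg)
  then have "shift t q q' \<in> commutant (cliff a b)"
    using shift_commute by (auto simp: commutant_def shift_def)
  then obtain f g h where S: "shift t q q' = opp (emb f g h)" "split1 h"
    using H sub unfolding intertw_alg_def by blast
  have E: "t p = h $$ (q,q')" if "p < 4" for p
  proof -
    have "t p = shift t q q' $$ (idx 0 p q', idx 0 p q)" using that q by (simp add: shift_def)
    also have "\<dots> = h $$ (q,q')" unfolding S using that q by (simp add: opp_emb_entry slot_def)
    finally show ?thesis .
  qed
  show "t p = t 2" using E[of p] E[of 2] p by simp
  show "t p = 0" if "(q = 0) \<noteq> (q' = 0)"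
    using E[OF p] S(2) q that unfolding split1_def by metis
qed

lemma Xmat_mat2:
  "Xmat (mat2 a b c d) = mat 4 4 (\<lambda>(i,j).
     [[0,0,a,b],[0,0,c,d],[cnj a,cnj c,0,0],[cnj b,cnj d,0,0]] ! i ! j)"
proof (rule eq_matI, goal_cases)
  case (1 i j)
  then have "i < 4" "j < 4" by auto
  then show ?case by (auto simp: less_four Xmat_def mat2_def)
qed (auto simp: Xmat_def)

lemma Hodge_necessary:
  fixes a13 a14 a23 a24 b13 b14 b23 b24 :: complex
  defines "a \<equiv> mat2 a13 a14 a23 a24" and "b \<equiv> mat2 b13 b14 b23 b24"
  assumes H: "commutant (cliff a b) = opp ` cliff a b"
  shows "no_zero_rows a" "no_zero_rows b" "a \<noteq> diag_phase \<phi> \<psi> * b"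
proof -
  \<comment> \<open>Column 0 is governed by \<open>a\<close> and every other column by
    \<open>b\<close>, so the choice of \<open>q\<close> lets one argument serve both
    matrices.\<close>
  have row: "\<not> (c13 = 0 \<and> c14 = 0) \<and> \<not> (c23 = 0 \<and> c24 = 0)"
    if q: "(q::nat) < 4" "(if q = 0 then Xmat a else Xmat b) = Xmat (mat2 c13 c14 c23 c24)" for q c13 c14 c23 c24
  proof (intro conjI notI)
    \<comment> \<open>A zero first row makes row 0 and column 0 of \<open>Xmat\<close> vanish, so
      the projection onto row 0 intertwines \<open>Xmat\<close> with itself, although its weights
      are not constant.\<close>
    assume z: "c13 = 0 \<and> c14 = 0"
    have "intertw (\<lambda>p. if p = 0 then 1 else 0) (Xmat (mat2 c13 c14 c23 c24)) (Xmat (mat2 c13 c14 c23 c24))"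
      unfolding intertw_def Xmat_mat2 using z by (auto simp: less_four)
    from Hodge_shift(1)[OF H, where p=0 and q=q and q'=q, unfolded q, OF _ this q(1) q(1)] show False by simp
  next
    assume z: "c23 = 0 \<and> c24 = 0"
    have "intertw (\<lambda>p. if p = 1 then 1 else 0) (Xmat (mat2 c13 c14 c23 c24)) (Xmat (mat2 c13 c14 c23 c24))"
      unfolding intertw_def Xmat_mat2 using z by (auto simp: less_four)
    from Hodge_shift(1)[OF H, where p=1 and q=q and q'=q, unfolded q, OF _ this q(1) q(1)] show False by simp
  qed
  show "no_zero_rows a" using row[of 0 a13 a14 a23 a24]
    by (fastforce simp: no_zero_rows_def a_def mat2_def less_two)
  show "no_zero_rows b" using row[of 1 b13 b14 b23 b24]
    by (fastforce simp: no_zero_rows_def b_def mat2_def less_two)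
  show "a \<noteq> diag_phase \<phi> \<psi> * b"
  proof
    assume eq: "a = diag_phase \<phi> \<psi> * b"
    have e: "a $$ (i,j) = (\<Sum>k<2. diag_phase \<phi> \<psi> $$ (i,k) * b $$ (k,j))" if "i < 2" "j < 2" for i j
      unfolding eq by (rule mult_mat_entry) (use that in \<open>auto simp: diag_phase_def b_def mat2_def\<close>)
    have "a13 = cis \<phi> * b13" "a14 = cis \<phi> * b14" "a23 = cis \<psi> * b23" "a24 = cis \<psi> * b24"
      using e[of 0 0] e[of 0 1] e[of 1 0] e[of 1 1]
      by (auto simp: a_def b_def mat2_def diag_phase_def numeral_2_eq_2)
    moreover have "cis x * (cnj (cis x) * y) = y" "cnj (cis x) * (cis x * y) = y" for x y
      by (simp_all add: cis_cnj mult.assoc[symmetric] cis_mult)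
    \<comment> \<open>The phases extended by 1 on rows 2 and 3 give a shift from column 1 to column
      0. This crosses the splitting of \<open>h\<close>, so the weight 1 at row 2 would have to be
      0.\<close>
    ultimately have "intertw (\<lambda>p. if p = 0 then cis \<phi> else if p = 1 then cis \<psi> else 1) (Xmat b) (Xmat a)"
      unfolding intertw_def a_def b_def Xmat_mat2 by (auto simp: less_four)
    from Hodge_shift(2)[OF H, where p=2 and q=1 and q'=0, simplified, OF _ this] show False by simp
  qed
qed

subsection \<open>Sufficiency: generating all block-diagonal operators\<close>

lemma eq_mat4I:
  assumes "A \<in> carrier_mat 4 4" "B \<in> carrier_mat 4 4"
    "\<And>i j. i \<in> {0,1,2,3} \<Longrightarrow> j \<in> {0,1,2,3} \<Longrightarrow> A $$ (i,j) = B $$ (i,j)"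
  shows "A = B"
  by (rule eq_matI) (use assms less_four in auto)

lemma cliff_closed:
  "x \<in> cliff a b \<Longrightarrow> y \<in> cliff a b \<Longrightarrow> x + y \<in> cliff a b"
  "x \<in> cliff a b \<Longrightarrow> y \<in> cliff a b \<Longrightarrow> x * y \<in> cliff a b"
  "x \<in> cliff a b \<Longrightarrow> c \<cdot>\<^sub>m x \<in> cliff a b"
  "x \<in> cliff a b \<Longrightarrow> cadj x \<in> cliff a b"
  unfolding cliff_def by (fact star_alg.intros)+

lemma cliff_algA: "algA \<subseteq> cliff a b"
  unfolding cliff_def by (auto intro: star_alg.gen)

lemma algA_memI: "m \<in> carrier_mat 3 3 \<Longrightarrow> emb (diag1 l z w) (diag1 l z w) (diag2 l m) \<in> algA"
  unfolding algA_emb by blast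

lemma cliff_diag: "m \<in> carrier_mat 3 3 \<Longrightarrow> emb (diag1 l z w) (diag1 l z w) (diag2 l m) \<in> cliff a b"
  using algA_memI cliff_algA by blast

text \<open>The generators have the form a[D_0,y]; the case a = 1 is available because A contains
  the identity.\<close>

lemma cliff_commutator:
  assumes y: "y \<in> algA"
  shows "D00 a b * y - y * D00 a b \<in> cliff a b"
proof -
  have d: "diag1 1 1 0 = 1\<^sub>m 4" "diag2 1 (1\<^sub>m 3) = 1\<^sub>m 4"
    by (rule eq_mat4I; auto simp: diag1_def diag2_def)+
  have "emb (diag1 1 1 0) (diag1 1 1 0) (diag2 1 (1\<^sub>m 3)) = 1\<^sub>m 32"
    unfolding d
  proof (rule eq_matI, goal_cases)
    case (1 i j)
    then show ?case using coords_cong[of i j] by (auto simp: emb_entry slot_def)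
  qed auto
  moreover have "emb (diag1 1 1 0) (diag1 1 1 0) (diag2 1 (1\<^sub>m 3)) \<in> algA"
    by (rule algA_memI) simp
  ultimately have 1: "1\<^sub>m 32 \<in> algA" by simp
  have "y \<in> carrier_mat 32 32" using y by (auto simp: algA_emb)
  then have "D00 a b * y - y * D00 a b \<in> carrier_mat 32 32"
    by (intro minus_carrier_mat mult_carrier_mat[where n=32]) (simp_all add: D0_emb)
  then have "D00 a b * y - y * D00 a b = 1\<^sub>m 32 * (D00 a b * y - y * D00 a b)"
    by (rule left_mult_one_mat[symmetric])
  then have "D00 a b * y - y * D00 a b \<in> {x * (D00 a b * y - y * D00 a b) | x y. x \<in> algA \<and> y \<in> algA}"
    using 1 y by blast
  then show ?thesis unfolding cliff_def by (intro star_alg.gen UnI2)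
qed

lemma cliff_combine:
  assumes "emb f g h \<in> cliff a b" "emb f' g' h' \<in> cliff a b"
    and "f \<in> carrier_mat 4 4" "g \<in> carrier_mat 4 4" "h \<in> carrier_mat 4 4"
    and "f' \<in> carrier_mat 4 4" "g' \<in> carrier_mat 4 4" "h' \<in> carrier_mat 4 4"
    and "F = c \<cdot>\<^sub>m f + d \<cdot>\<^sub>m f'" "G = c \<cdot>\<^sub>m g + d \<cdot>\<^sub>m g'" "H = c \<cdot>\<^sub>m h + d \<cdot>\<^sub>m h'"
  shows "emb F G H \<in> cliff a b"
proof -
  have "emb F G H = c \<cdot>\<^sub>m emb f g h + d \<cdot>\<^sub>m emb f' g' h'"
    using assms by (simp add: emb_smult emb_add)
  then show ?thesis using assms by (simp add: cliff_closed)
qed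

text \<open>A is only a real algebra. Over the complex numbers, the values 1 and \<open>\<i>\<close>
  of a parameter can be combined to separate it from its conjugate. The first unit keeps a third
  component because \<open>l\<close> also occurs in \<open>diag2\<close>.\<close>

lemma cliff_units:
  "emb (eu 4 0 0) (eu 4 0 0) (eu 4 0 0) \<in> cliff a b"
  "emb (eu 4 1 1) (eu 4 1 1) (0\<^sub>m 4 4) \<in> cliff a b"
  "emb (eu 4 2 2) (eu 4 2 2) (0\<^sub>m 4 4) \<in> cliff a b"
  "emb (eu 4 3 3) (eu 4 3 3) (0\<^sub>m 4 4) \<in> cliff a b"
  "emb (eu 4 2 3) (eu 4 2 3) (0\<^sub>m 4 4) \<in> cliff a b"
  "emb (eu 4 3 2) (eu 4 3 2) (0\<^sub>m 4 4) \<in> cliff a b"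
proof -
  let ?z = "0\<^sub>m 3 3"
  have D: "emb (diag1 l z w) (diag1 l z w) (diag2 l ?z) \<in> cliff a b" for l z w
    by (rule cliff_diag) simp
  show "emb (eu 4 0 0) (eu 4 0 0) (eu 4 0 0) \<in> cliff a b"
    by (rule cliff_combine[OF D[of 1 0 0] D[of \<i> 0 0], where c = "1/2" and d = "- \<i>/2"]; 
      (rule eq_mat4I)?; auto simp: diag1_def diag2_def eu_entry)
  show "emb (eu 4 1 1) (eu 4 1 1) (0\<^sub>m 4 4) \<in> cliff a b"
    by (rule cliff_combine[OF D[of 1 0 0] D[of \<i> 0 0], where c = "1/2" and d = "\<i>/2"]; 
      (rule eq_mat4I)?; auto simp: diag1_def diag2_def eu_entry)
  show "emb (eu 4 2 2) (eu 4 2 2) (0\<^sub>m 4 4) \<in> cliff a b"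
    by (rule cliff_combine[OF D[of 0 1 0] D[of 0 \<i> 0], where c = "1/2" and d = "- \<i>/2"]; 
      (rule eq_mat4I)?; auto simp: diag1_def diag2_def eu_entry)
  show "emb (eu 4 3 3) (eu 4 3 3) (0\<^sub>m 4 4) \<in> cliff a b"
    by (rule cliff_combine[OF D[of 0 1 0] D[of 0 \<i> 0], where c = "1/2" and d = "\<i>/2"]; 
      (rule eq_mat4I)?; auto simp: diag1_def diag2_def eu_entry)
  show "emb (eu 4 2 3) (eu 4 2 3) (0\<^sub>m 4 4) \<in> cliff a b"
    by (rule cliff_combine[OF D[of 0 0 1] D[of 0 0 \<i>], where c = "1/2" and d = "- \<i>/2"]; 
      (rule eq_mat4I)?; auto simp: diag1_def diag2_def eu_entry)
  show "emb (eu 4 3 2) (eu 4 3 2) (0\<^sub>m 4 4) \<in> cliff a b"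
    by (rule cliff_combine[OF D[of 0 0 1] D[of 0 0 \<i>], where c = "-1/2" and d = "- \<i>/2"]; 
      (rule eq_mat4I)?; auto simp: diag1_def diag2_def eu_entry)
qed

text \<open>These are matrix units with coefficients in C (+) C: \<open>s\<close> belongs to column
  0 of the first summand and \<open>t\<close> to its other three columns. They multiply like
  ordinary matrix units, with coefficients multiplied componentwise.\<close>

definition unit2 :: "complex \<Rightarrow> complex \<Rightarrow> nat \<Rightarrow> nat \<Rightarrow> complex mat" where
  "unit2 s t i j = emb (s \<cdot>\<^sub>m eu 4 i j) (t \<cdot>\<^sub>m eu 4 i j) (0\<^sub>m 4 4)"

lemma sum_four: "(\<Sum>p<4. F p) = F 0 + F 1 + F 2 + F (3::nat)" for F :: "nat \<Rightarrow> complex"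
  by (simp add: numeral_eq_Suc)

lemma eu_mult: "j < n \<Longrightarrow> eu n i j * eu n j l = eu n i l"
  by (rule eq_matI)
    (auto simp: mult_mat_entry[where n=n] eu_entry if_distrib[of "\<lambda>x. x * _"] cong: if_cong)

lemma smult_smult: "c \<cdot>\<^sub>m (d \<cdot>\<^sub>m A) = (c * d :: complex) \<cdot>\<^sub>m A"
  by (rule eq_matI) (auto simp: mult.assoc)

lemma unit2_mult: "j < 4 \<Longrightarrow> unit2 s t i j * unit2 s' t' j l = unit2 (s * s') (t * t') i l"
proof -
  assume j: "j < 4"
  have "(x \<cdot>\<^sub>m eu 4 i j) * (y \<cdot>\<^sub>m eu 4 j l) = (x * y) \<cdot>\<^sub>m eu 4 i l" for x y :: complex
  proof -
    have "(x \<cdot>\<^sub>m eu 4 i j) * (y \<cdot>\<^sub>m eu 4 j l) = x \<cdot>\<^sub>m (y \<cdot>\<^sub>m (eu 4 i j * eu 4 j l))"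
      using mult_smult_assoc_mat[of "eu 4 i j" 4 4 "y \<cdot>\<^sub>m eu 4 j l" 4 x]
        mult_smult_distrib[of "eu 4 i j" 4 4 "eu 4 j l" 4 y] by simp
    then show ?thesis by (simp add: eu_mult[OF j] smult_smult)
  qed
  then show ?thesis by (simp add: unit2_def emb_mult)
qed

lemma unit2_cadj: "cadj (unit2 s t i j) = unit2 (cnj s) (cnj t) j i"
proof -
  have "cadj (x \<cdot>\<^sub>m eu 4 i j) = cnj x \<cdot>\<^sub>m eu 4 j i" for x
    by (rule eq_matI) (auto simp: cadj_entry eu_entry)
  moreover have "cadj (0\<^sub>m 4 4) = 0\<^sub>m 4 4"
    by (rule eq_matI) (auto simp: cadj_entry)
  ultimately show ?thesis by (simp add: unit2_def emb_cadj)
qed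

lemma unit2_combine:
  "c \<cdot>\<^sub>m unit2 s t i j + d \<cdot>\<^sub>m unit2 s' t' i j = unit2 (c * s + d * s') (c * t + d * t') i j"
proof -
  have "c \<cdot>\<^sub>m (x \<cdot>\<^sub>m eu 4 i j) + d \<cdot>\<^sub>m (y \<cdot>\<^sub>m eu 4 i j) = (c * x + d * y) \<cdot>\<^sub>m eu 4 i j" for x y
    by (rule eq_matI) (auto simp: algebra_simps)
  moreover have "c \<cdot>\<^sub>m 0\<^sub>m 4 4 + d \<cdot>\<^sub>m 0\<^sub>m 4 4 = 0\<^sub>m 4 4" by (rule eq_matI) auto
  ultimately show ?thesis by (simp add: unit2_def emb_smult emb_add)
qed

lemma unit2_smult: "c \<cdot>\<^sub>m unit2 s t i j = unit2 (c * s) (c * t) i j"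
proof -
  have "c \<cdot>\<^sub>m (0\<^sub>m 4 4) = 0\<^sub>m 4 4" by (rule eq_matI) auto
  then show ?thesis by (simp add: unit2_def emb_smult smult_smult)
qed

lemma eu_sandwich:
  assumes "M \<in> carrier_mat 4 4" "i < 4" "j < 4"
  shows "eu 4 i i * M * eu 4 j j = M $$ (i,j) \<cdot>\<^sub>m eu 4 i j"
proof (rule eq_matI, goal_cases)
  case (1 k l)
  then have kl: "k < 4" "l < 4" by auto
  have "(eu 4 i i * M * eu 4 j j) $$ (k,l) = (\<Sum>n<4. (eu 4 i i * M) $$ (k,n) * eu 4 j j $$ (n,l))"
    by (rule mult_mat_entry) (use assms kl in auto)
  also have "\<dots> = (if l = j then (eu 4 i i * M) $$ (k,j) else 0)"
    using kl assms by (simp add: eu_entry if_distrib[of "\<lambda>x. _ * x"] cong: if_cong)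
  also have "(eu 4 i i * M) $$ (k,j) = (\<Sum>n<4. eu 4 i i $$ (k,n) * M $$ (n,j))"
    by (rule mult_mat_entry) (use assms kl in auto)
  also have "\<dots> = (if k = i then M $$ (i,j) else 0)"
    using kl assms by (simp add: eu_entry if_distrib[of "\<lambda>x. x * _"] cong: if_cong)
  finally show ?case using kl by (simp add: eu_entry)
qed (use assms in auto)

lemma one_smult_mat [simp]: "(1::complex) \<cdot>\<^sub>m A = A"
  by (rule eq_matI) auto

lemma unit2_one:
  assumes "j \<in> {2,3}" "k \<in> {2,3}"
  shows "unit2 1 1 j k \<in> cliff a b"
  using assms cliff_units by (auto simp: unit2_def)

text \<open>Compressing a commutator with D_0 by diagonal units isolates a single entry of both
  \<open>Xmat a\<close> and \<open>Xmat b\<close>. Moving it to column 2 makes the results for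
  different \<open>j\<close> comparable.\<close>

lemma unit2_X:
  assumes i: "i < 2" and j: "j \<in> {2,3}"
  shows "unit2 (Xmat a $$ (i,j)) (Xmat b $$ (i,j)) i 2 \<in> cliff a b"
proof -
  \<comment> \<open>\<open>?d\<close> is the projection onto rows 0 and 1, so its commutator with
    \<open>Xmat\<close> has the upper right block of \<open>Xmat\<close> with the sign
    reversed.\<close>
  let ?d = "diag1 1 0 0" let ?h = "diag2 1 (0\<^sub>m 3 3)"
  let ?c = "\<lambda>X. X * ?d - ?d * X"
  have j4: "i < 4" "j < 4" using i j by auto
  have ent: "?c (Xmat x) $$ (i,j) = - Xmat x $$ (i,j)" for x
  proof -
    have d: "?d $$ (p,q) = (if p = q \<and> p < 2 then 1 else 0)" if "p < 4" "q < 4" for p q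
      using that by (auto simp: diag1_def)
    show ?thesis using i j
      by (auto simp: mult_mat_entry[where n=4] sum_four d less_two carrier_matD[OF Xmat_carrier] carrier_matD[OF diag1_carrier])
  qed
  have "emb ?d ?d ?h \<in> algA"
    by (rule algA_memI) simp
  from cliff_commutator[OF this] have C: "D00 a b * emb ?d ?d ?h - emb ?d ?d ?h * D00 a b \<in> cliff a b" .
  have z: "0\<^sub>m 4 4 * ?h - ?h * 0\<^sub>m 4 4 = 0\<^sub>m 4 4"
    using left_mult_zero_mat[OF diag2_carrier[of 1 "0\<^sub>m 3 3"], of 4]
      right_mult_zero_mat[OF diag2_carrier[of 1 "0\<^sub>m 3 3"], of 4]
    by (simp add: minus_r_inv_mat[where nr=4 and nc=4])
  have "D00 a b * emb ?d ?d ?h - emb ?d ?d ?h * D00 a b = emb (?c (Xmat a)) (?c (Xmat b)) (0\<^sub>m 4 4)"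
  proof -
    have c4: "Xmat x * ?d \<in> carrier_mat 4 4" "?d * Xmat x \<in> carrier_mat 4 4"
      "0\<^sub>m 4 4 * ?h \<in> carrier_mat 4 4" "?h * 0\<^sub>m 4 4 \<in> carrier_mat 4 4" for x
      by (auto intro!: mult_carrier_mat[where n=4])
    have "D00 a b * emb ?d ?d ?h - emb ?d ?d ?h * D00 a b =
        emb (Xmat a * ?d) (Xmat b * ?d) (0\<^sub>m 4 4 * ?h) - emb (?d * Xmat a) (?d * Xmat b) (?h * 0\<^sub>m 4 4)"
      unfolding D0_emb by (subst (1 2) emb_mult) simp_all
    also have "\<dots> = emb (?c (Xmat a)) (?c (Xmat b)) (0\<^sub>m 4 4 * ?h - ?h * 0\<^sub>m 4 4)"
      by (intro emb_minus c4)
    finally show ?thesis unfolding z .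
  qed
  with C have C: "emb (?c (Xmat a)) (?c (Xmat b)) (0\<^sub>m 4 4) \<in> cliff a b" by simp
  \<comment> \<open>The third component differs between rows 0 and 1, but it is multiplied by the
    zero third component of the commutator.\<close>
  obtain h where h: "h \<in> carrier_mat 4 4" "emb (eu 4 i i) (eu 4 i i) h \<in> cliff a b"
  proof (cases "i = 0")
    case True
    then show ?thesis using that[of "eu 4 0 0"] cliff_units(1) by simp
  next
    case False
    then show ?thesis using i that[of "0\<^sub>m 4 4"] cliff_units(2) less_two by auto
  qed
  have "emb (eu 4 i i) (eu 4 i i) h * emb (?c (Xmat a)) (?c (Xmat b)) (0\<^sub>m 4 4) * emb (eu 4 j j) (eu 4 j j) (0\<^sub>m 4 4)
      = unit2 (- Xmat a $$ (i,j)) (- Xmat b $$ (i,j)) i j"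
  proof -
    have c4: "?c (Xmat x) \<in> carrier_mat 4 4" for x
      by (auto intro!: mult_carrier_mat[where n=4] minus_carrier_mat)
    have "emb (eu 4 i i) (eu 4 i i) h * emb (?c (Xmat a)) (?c (Xmat b)) (0\<^sub>m 4 4) =
        emb (eu 4 i i * ?c (Xmat a)) (eu 4 i i * ?c (Xmat b)) (0\<^sub>m 4 4)"
      using emb_mult[OF eu_carrier eu_carrier h(1) c4 c4 zero_carrier_mat]
      by (simp add: right_mult_zero_mat[OF h(1)])
    moreover have "emb (eu 4 i i * ?c (Xmat a)) (eu 4 i i * ?c (Xmat b)) (0\<^sub>m 4 4) *
        emb (eu 4 j j) (eu 4 j j) (0\<^sub>m 4 4) = emb (eu 4 i i * ?c (Xmat a) * eu 4 j j)
          (eu 4 i i * ?c (Xmat b) * eu 4 j j) (0\<^sub>m 4 4 * 0\<^sub>m 4 4)"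
      by (intro emb_mult mult_carrier_mat[OF eu_carrier c4] eu_carrier zero_carrier_mat)
    ultimately show ?thesis
      unfolding unit2_def by (simp only: eu_sandwich[OF c4 j4] ent left_mult_zero_mat[OF zero_carrier_mat])
  qed
  moreover have "emb (eu 4 j j) (eu 4 j j) (0\<^sub>m 4 4) \<in> cliff a b" using j cliff_units by auto
  ultimately have "unit2 (- Xmat a $$ (i,j)) (- Xmat b $$ (i,j)) i j \<in> cliff a b"
    using h C cliff_closed(2) by metis
  then have "(-1) \<cdot>\<^sub>m (unit2 (- Xmat a $$ (i,j)) (- Xmat b $$ (i,j)) i j * unit2 1 1 j 2) \<in> cliff a b"
    using j by (intro cliff_closed unit2_one) auto
  then show ?thesis using j4 by (simp add: unit2_mult unit2_smult)
qed

text \<open>A row vector is determined up to a phase by the products of its entries with their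
  conjugates. A nonzero entry fixes the phase, and the mixed product carries it to the other
  entry.\<close>

lemma phase_of_equal_products:
  fixes x y u v :: complex
  assumes "cnj x * x = cnj u * u" "cnj y * y = cnj v * v" "cnj x * y = cnj u * v"
  shows "\<exists>\<phi>. x = cis \<phi> * u \<and> y = cis \<phi> * v"
proof -
  have norm: "cmod p = cmod q" if "cnj p * p = cnj q * q" for p q
  proof -
    have "complex_of_real ((cmod p)\<^sup>2) = of_real ((cmod q)\<^sup>2)"
      using that by (simp only: complex_norm_square mult.commute)
    then have "(cmod p)\<^sup>2 = (cmod q)\<^sup>2" by (simp only: of_real_eq_iff)
    then show ?thesis by (simp add: power2_eq_imp_eq)
  qed
  have n: "cmod x = cmod u" "cmod y = cmod v" using assms(1,2) by (blast intro: norm)+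
  have phase: "\<exists>\<phi>. p = cis \<phi> * q" if "cmod p = cmod q" "q \<noteq> 0" for p q
  proof -
    have "cmod (p / q) = 1" using that by (simp add: norm_divide)
    then have "cis (Arg (p / q)) = p / q" using rcis_cmod_Arg[of "p / q"] by (simp add: rcis_def)
    then have "p = cis (Arg (p / q)) * q" using that(2) by simp
    then show ?thesis ..
  qed
  show ?thesis
  proof (cases "u = 0")
    \<comment> \<open>Here \<open>x\<close> vanishes too, so the phase is read off from the second
      entry; if that is zero as well, any phase will do.\<close>
    case True
    then have "x = 0" using n by simp
    show ?thesis
    proof (cases "v = 0")
      case True
      then show ?thesis using \<open>u = 0\<close> \<open>x = 0\<close> n by simp
    next
      case False
      then show ?thesis using phase[OF n(2)] \<open>u = 0\<close> \<open>x = 0\<close> by simp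
    qed
  next
    case False
    then obtain \<phi> where \<phi>: "x = cis \<phi> * u" using phase n by blast
    have "cis \<phi> * cnj x = cnj u"
    proof -
      have "cis \<phi> * cnj x = (cis \<phi> * cis (- \<phi>)) * cnj u"
        unfolding \<phi> complex_cnj_mult cis_cnj by (rule mult.assoc[symmetric])
      then show ?thesis by (simp add: cis_mult)
    qed
    then have "cnj u * y = cis \<phi> * (cnj x * y)" by (metis mult.assoc)
    also have "\<dots> = cnj u * (cis \<phi> * v)" unfolding assms(3) by (rule mult.left_commute)
    finally show ?thesis using \<phi> False by auto
  qed
qed


lemma cliff_separates:
  assumes "a \<in> carrier_mat 2 2" "b \<in> carrier_mat 2 2"
    and np: "\<not> (\<exists>\<phi> \<psi>. a = diag_phase \<phi> \<psi> * b)"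
  shows "\<exists>s t. s \<noteq> t \<and> unit2 s t 2 2 \<in> cliff a b"
proof (rule ccontr)
  assume "\<not> ?thesis"
  then have eq: "s = t" if "unit2 s t 2 2 \<in> cliff a b" for s t using that by blast
  have "\<exists>\<phi>. a $$ (i,0) = cis \<phi> * b $$ (i,0) \<and> a $$ (i,1) = cis \<phi> * b $$ (i,1)" if i: "i < 2" for i
  proof -
    have X: "Xmat x $$ (i,2) = x $$ (i,0)" "Xmat x $$ (i,3) = x $$ (i,1)" for x
      using i by (auto simp: Xmat_def)
    have prod: "cnj (Xmat a $$ (i,j)) * Xmat a $$ (i,k) = cnj (Xmat b $$ (i,j)) * Xmat b $$ (i,k)"
      if "j \<in> {2,3}" "k \<in> {2,3}" for j k
    proof (rule eq)
      \<comment> \<open>The adjoint leads from row \<open>i\<close> back to row 2, so the product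
        lies in the corner (2,2), where the assumption equates both coefficients.\<close>
      have "cadj (unit2 (Xmat a $$ (i,j)) (Xmat b $$ (i,j)) i 2) * unit2 (Xmat a $$ (i,k)) (Xmat b $$ (i,k)) i 2
          \<in> cliff a b"
        using i that by (intro cliff_closed unit2_X)
      then show "unit2 (cnj (Xmat a $$ (i,j)) * Xmat a $$ (i,k)) (cnj (Xmat b $$ (i,j)) * Xmat b $$ (i,k)) 2 2
          \<in> cliff a b"
        using i by (simp add: unit2_cadj unit2_mult)
    qed
    show ?thesis
      using prod[of 2 2] prod[of 3 3] prod[of 2 3] by (intro phase_of_equal_products) (simp_all add: X)
  qed
  from this[of 0] this[of 1] obtain \<phi> \<psi> where
    e: "a $$ (0,0) = cis \<phi> * b $$ (0,0)" "a $$ (0,1) = cis \<phi> * b $$ (0,1)"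
      "a $$ (1,0) = cis \<psi> * b $$ (1,0)" "a $$ (1,1) = cis \<psi> * b $$ (1,1)" by auto
  have "a = diag_phase \<phi> \<psi> * b"
  proof (rule eq_matI, goal_cases)
    case (1 i j)
    then have "i < 2" "j < 2" using assms by (auto simp: diag_phase_def)
    moreover from this have "(diag_phase \<phi> \<psi> * b) $$ (i,j) = (\<Sum>k<2. diag_phase \<phi> \<psi> $$ (i,k) * b $$ (k,j))"
      by (intro mult_mat_entry) (use assms in \<open>auto simp: diag_phase_def\<close>)
    moreover have "(\<Sum>k<2. F k) = F 0 + F 1" for F :: "nat \<Rightarrow> complex"
      by (simp add: numeral_2_eq_2)
    ultimately show ?case
      using e by (auto simp: less_two diag_phase_def)
  qed (use assms in \<open>auto simp: diag_phase_def\<close>)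
  then show False using np by blast
qed

text \<open>For distinct \<open>s\<close> and \<open>t\<close> the pairs (s,t) and (1,1) form a
  basis of C^2; the coefficients below solve for (1,0) and (0,1).\<close>

lemma cliff_corner:
  assumes "s \<noteq> t" "unit2 s t 2 2 \<in> cliff a b"
  shows "unit2 1 0 2 2 \<in> cliff a b" "unit2 0 1 2 2 \<in> cliff a b"
proof -
  have one: "unit2 1 1 2 2 \<in> cliff a b" by (rule unit2_one) auto
  have d: "s - t \<noteq> 0" using assms by simp
  have "(1 / (s - t)) \<cdot>\<^sub>m unit2 s t 2 2 + (- t / (s - t)) \<cdot>\<^sub>m unit2 1 1 2 2 \<in> cliff a b"
    using assms one by (intro cliff_closed)
  moreover have "1 / (s - t) * s + - t / (s - t) * 1 = 1" "1 / (s - t) * t + - t / (s - t) * 1 = 0"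
    using d by (simp_all add: divide_simps)
  ultimately show "unit2 1 0 2 2 \<in> cliff a b" by (simp only: unit2_combine)
  have "(- 1 / (s - t)) \<cdot>\<^sub>m unit2 s t 2 2 + (s / (s - t)) \<cdot>\<^sub>m unit2 1 1 2 2 \<in> cliff a b"
    using assms one by (intro cliff_closed)
  moreover have "- 1 / (s - t) * s + s / (s - t) * 1 = 0" "- 1 / (s - t) * t + s / (s - t) * 1 = 1"
    using d by (simp_all add: divide_simps)
  ultimately show "unit2 0 1 2 2 \<in> cliff a b" by (simp only: unit2_combine)
qed

text \<open>The pair (x,y) is one of the two idempotents, so the linear form in \<open>rows\<close>
  is the entry of \<open>Xmat a\<close> or of \<open>Xmat b\<close>. A nonzero entry, once divided
  out, connects the corner to row 0 or 1; the quaternion units reach row 3.\<close>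

lemma cliff_unit2:
  assumes corner: "unit2 x y 2 2 \<in> cliff a b" and xy: "(x,y) \<in> {(1,0),(0,1)}"
    and rows: "\<And>i. i < 2 \<Longrightarrow> \<exists>j\<in>{2,3}. x * Xmat a $$ (i,j) + y * Xmat b $$ (i,j) \<noteq> 0"
    and kl: "k < 4" "l < 4"
  shows "unit2 x y k l \<in> cliff a b"
proof -
  have col: "unit2 x y i 2 \<in> cliff a b" if "i < 4" for i
  proof (cases "i < 2")
    case True
    then obtain j where j: "j \<in> {2,3}" and nz: "x * Xmat a $$ (i,j) + y * Xmat b $$ (i,j) \<noteq> 0"
      using rows by blast
    let ?w = "x * Xmat a $$ (i,j) + y * Xmat b $$ (i,j)"
    have "(1 / ?w) \<cdot>\<^sub>m (unit2 (Xmat a $$ (i,j)) (Xmat b $$ (i,j)) i 2 * unit2 x y 2 2) \<in> cliff a b"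
      using True j corner by (intro cliff_closed unit2_X)
    moreover have "1 / ?w * (Xmat a $$ (i,j) * x) = x" "1 / ?w * (Xmat b $$ (i,j) * y) = y"
      using nz xy by auto
    ultimately show ?thesis by (simp add: unit2_mult unit2_smult)
  next
    case False
    then have "i \<in> {2,3}" using that by auto
    then have "unit2 1 1 i 2 * unit2 x y 2 2 \<in> cliff a b"
      using corner by (intro cliff_closed unit2_one) auto
    then show ?thesis by (simp add: unit2_mult)
  qed
  have "unit2 x y k 2 * cadj (unit2 x y l 2) \<in> cliff a b"
    using col kl by (intro cliff_closed)
  then show ?thesis using xy by (auto simp: unit2_cadj unit2_mult)
qed

lemma cliff_block:
  assumes u: "\<And>k l. k < 4 \<Longrightarrow> l < 4 \<Longrightarrow> unit2 x y k l \<in> cliff a b"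
    and f: "f \<in> carrier_mat 4 4"
  shows "emb (x \<cdot>\<^sub>m f) (y \<cdot>\<^sub>m f) (0\<^sub>m 4 4) \<in> cliff a b"
proof -
  \<comment> \<open>\<open>?p S\<close> truncates \<open>f\<close> to the positions in
    \<open>S\<close>, so that \<open>f\<close> is built up by adding one matrix unit at a
    time.\<close>
  let ?p = "\<lambda>S. mat 4 4 (\<lambda>ij. if ij \<in> S then f $$ ij else 0)"
  have "emb (x \<cdot>\<^sub>m ?p S) (y \<cdot>\<^sub>m ?p S) (0\<^sub>m 4 4) \<in> cliff a b" if "finite S" "S \<subseteq> {..<4} \<times> {..<4}" for S
    using that
  proof (induction S rule: finite_induct)
    case empty
    have "emb (x \<cdot>\<^sub>m ?p {}) (y \<cdot>\<^sub>m ?p {}) (0\<^sub>m 4 4) = 0\<^sub>m 32 32"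
      by (rule eq_matI) (auto simp: emb_entry slot_def)
    then show ?case unfolding cliff_def by (simp only: star_alg.zero)
  next
    case (insert kl S)
    obtain k l where kl: "kl = (k,l)" by force
    have "f $$ (k,l) \<cdot>\<^sub>m unit2 x y k l + emb (x \<cdot>\<^sub>m ?p S) (y \<cdot>\<^sub>m ?p S) (0\<^sub>m 4 4) \<in> cliff a b"
      using insert kl by (intro cliff_closed u) auto
    also have "f $$ (k,l) \<cdot>\<^sub>m unit2 x y k l + emb (x \<cdot>\<^sub>m ?p S) (y \<cdot>\<^sub>m ?p S) (0\<^sub>m 4 4)
        = emb (x \<cdot>\<^sub>m ?p (insert kl S)) (y \<cdot>\<^sub>m ?p (insert kl S)) (0\<^sub>m 4 4)"
      by (rule eq_matI)
        (use insert.hyps(2) in \<open>auto simp: kl unit2_def emb_entry slot_def eu_entry\<close>)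
    finally show ?case .
  qed
  from this[of "{..<4} \<times> {..<4}"] have "emb (x \<cdot>\<^sub>m ?p ({..<4} \<times> {..<4})) (y \<cdot>\<^sub>m ?p ({..<4} \<times> {..<4})) (0\<^sub>m 4 4) \<in> cliff a b"
    by simp
  also have "?p ({..<4} \<times> {..<4}) = f" by (rule eq_matI) (use f in auto)
  finally show ?thesis .
qed

lemma cliff_full:
  assumes u: "\<And>k l. k < 4 \<Longrightarrow> l < 4 \<Longrightarrow> unit2 1 0 k l \<in> cliff a b"
      "\<And>k l. k < 4 \<Longrightarrow> l < 4 \<Longrightarrow> unit2 0 1 k l \<in> cliff a b"
    and c: "f \<in> carrier_mat 4 4" "g \<in> carrier_mat 4 4" "h \<in> carrier_mat 4 4" and h: "split1 h"
  shows "emb f g h \<in> cliff a b"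
proof -
  let ?m = "mat 3 3 (\<lambda>(i,j). h $$ (i + 1, j + 1))"
  \<comment> \<open>The only unit that supplies the entry (0,0) of \<open>h\<close> also contributes
    e_11 to the first two components; subtracting this beforehand compensates.\<close>
  let ?F = "f - h $$ (0,0) \<cdot>\<^sub>m eu 4 0 0" and ?G = "g - h $$ (0,0) \<cdot>\<^sub>m eu 4 0 0"
  let ?S = "emb (1 \<cdot>\<^sub>m ?F) (0 \<cdot>\<^sub>m ?F) (0\<^sub>m 4 4) + emb (0 \<cdot>\<^sub>m ?G) (1 \<cdot>\<^sub>m ?G) (0\<^sub>m 4 4)
      + h $$ (0,0) \<cdot>\<^sub>m emb (eu 4 0 0) (eu 4 0 0) (eu 4 0 0)
      + emb (diag1 0 0 0) (diag1 0 0 0) (diag2 0 ?m)"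
  have FG: "?F \<in> carrier_mat 4 4" "?G \<in> carrier_mat 4 4" using c by auto
  have "?S \<in> cliff a b"
    by (intro cliff_closed cliff_block u cliff_units cliff_diag FG) simp_all
  also have "?S = emb f g h"
  proof (rule eq_matI, goal_cases)
    case (1 i j)
    then have ij: "i < 32" "j < 32" by auto
    have z: "h $$ (p,q) = 0" if "p < 4" "q < 4" "(p = 0) \<noteq> (q = 0)" for p q
      using h that unfolding split1_def by blast
    show ?case
      using ij c z[of "rw i" "rw j"] coords_less(2)[of i] coords_less(2)[of j]
      by (auto simp: emb_entry slot_def eu_entry diag1_def diag2_def simp del: coords_less)
  qed auto
  finally show ?thesis .
qed

text \<open>Commuting with the matrix units of all three factors forces T to preserve row and
  factor, and to act on columns independently of the row within each block of a factor. What remains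
  is right multiplication, that is, an opposite.\<close>

lemma commutant_full:
  assumes full: "\<And>f g h. f \<in> carrier_mat 4 4 \<Longrightarrow> g \<in> carrier_mat 4 4 \<Longrightarrow> h \<in> carrier_mat 4 4 \<Longrightarrow>
      split1 h \<Longrightarrow> emb f g h \<in> C"
    and T: "T \<in> commutant C"
  shows "\<exists>f g h. f \<in> carrier_mat 4 4 \<and> g \<in> carrier_mat 4 4 \<and> h \<in> carrier_mat 4 4 \<and> split1 h \<and>
      T = opp (emb f g h)"
proof -
  have cT: "T \<in> carrier_mat 32 32" using T by (simp add: commutant_def)
  \<comment> \<open>The number of the factor \<open>f\<close>, \<open>g\<close> or \<open>h\<close>
    that acts on column \<open>q\<close> of summand \<open>s\<close>.\<close>
  define kind where "kind s q = (if s = 0 then if q = 0 then 0 else 1 else 2 :: nat)" for s q :: nat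
  \<comment> \<open>Both sides are the (i,j) entry of E T = T E, for E the unit e_xy in factor
    \<open>c\<close>. In factor 2 the unit must respect the splitting.\<close>
  have rel: "(if kind (blk i) (cl i) = c \<and> rw i = x then T $$ (idx (blk i) y (cl i), j) else 0) =
      (if kind (blk j) (cl j) = c \<and> rw j = y then T $$ (i, idx (blk j) x (cl j)) else 0)"
    if ij: "i < 32" "j < 32" and xy: "x < 4" "y < 4" and c: "c < 3" "c = 2 \<Longrightarrow> (x = 0) = (y = 0)" for i j x y c
  proof -
    define e where "e k = (if c = k then eu 4 x y else 0\<^sub>m 4 4)" for k :: nat
    let ?E = "emb (e 0) (e (Suc 0)) (e 2)"
    have "split1 (e 2)" using xy c by (auto simp: e_def split1_def eu_entry)
    then have "?E \<in> C" by (intro full) (auto simp: e_def)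
    then have com: "(?E * T) $$ (i,j) = (T * ?E) $$ (i,j)" using T by (simp add: commutant_def)
    have sl: "slot (e 0) (e (Suc 0)) (e 2) s q $$ (k,l) = (if kind s q = c \<and> k = x \<and> l = y then 1 else 0)"
      if "k < 4" "l < 4" for s q k l
      using that c by (auto simp: e_def slot_def kind_def eu_entry)
    have L: "(?E * T) $$ (i,j) = (if kind (blk i) (cl i) = c \<and> rw i = x then T $$ (idx (blk i) y (cl i), j) else 0)"
      using ij xy cT by (auto simp: emb_mult_left sl if_distrib[of "\<lambda>x. x * _"] cong: if_cong intro!: sum.neutral)
    have R: "(T * ?E) $$ (i,j) = (if kind (blk j) (cl j) = c \<and> rw j = y then T $$ (i, idx (blk j) x (cl j)) else 0)"
      using ij xy cT by (auto simp: emb_mult_right sl if_distrib[of "\<lambda>x. _ * x"] cong: if_cong intro!: sum.neutral)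
    show ?thesis using com unfolding L R .
  qed
  have k3: "kind s q < 3" for s q by (simp add: kind_def)
  \<comment> \<open>A diagonal unit in the factor and row of \<open>i\<close> keeps the entry on the
    left, while on the right it gives 0 when \<open>j\<close> has another factor or row.\<close>
  have zero: "T $$ (i,j) = 0" if "i < 32" "j < 32" "kind (blk i) (cl i) \<noteq> kind (blk j) (cl j) \<or> rw i \<noteq> rw j" for i j
    using rel[of i j "rw i" "rw i" "kind (blk i) (cl i)"] that k3 by auto
  \<comment> \<open>An off-diagonal unit transports entries of T from row \<open>x\<close> to row
    \<open>y\<close>; in the second summand it cannot connect row 0 to the others.\<close>
  have move: "T $$ (idx s x q, idx s x q') = T $$ (idx s y q, idx s y q')"
    if "s < 2" "x < 4" "y < 4" "q < 4" "q' < 4" "kind s q = kind s q'" "s = 1 \<Longrightarrow> (x = 0) = (y = 0)" for s x y q q'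
    using rel[of "idx s y q" "idx s x q'" y x "kind s q"] that k3[of s q] by (auto simp: kind_def split: if_splits)
  \<comment> \<open>Opposites exchange the summands and transpose. Hence \<open>?f\<close> and
    \<open>?g\<close> come from rows 0 and 1 of the second summand, row 1 standing for rows 1 to 3,
    and \<open>?h\<close> comes from row 0 of the first.\<close>
  let ?f = "mat 4 4 (\<lambda>(x,y). T $$ (idx 1 0 y, idx 1 0 x))"
  let ?g = "mat 4 4 (\<lambda>(x,y). T $$ (idx 1 1 y, idx 1 1 x))"
  let ?h = "mat 4 4 (\<lambda>(x,y). T $$ (idx 0 0 y, idx 0 0 x))"
  have "split1 ?h" unfolding split1_def by (auto intro!: zero simp: kind_def)
  moreover have "T = opp (emb ?f ?g ?h)"
  proof (rule eq_matI, goal_cases)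
    case (1 i j)
    then have ij: "i < 32" "j < 32" by (auto simp: opp_def Jconj_def)
    show ?case
    proof (cases "blk i = blk j \<and> rw i = rw j")
      case False
      then have "T $$ (i,j) = 0" using ij less_two[of "blk i"] less_two[of "blk j"]
        by (intro zero) (auto simp: kind_def)
      then show ?thesis using ij False by (auto simp: opp_emb_entry)
    next
      case True
      define s x where "s = blk i" and "x = rw i"
      have ie: "i = idx s x (cl i)" "j = idx s x (cl j)"
        using True unfolding s_def x_def by (metis idx_coords)+
      have sx: "s < 2" "x < 4" using ij by (auto simp: s_def x_def)
      have rhs: "opp (emb ?f ?g ?h) $$ (i,j) = slot ?f ?g ?h (1 - s) x $$ (cl j, cl i)"
        using ij True by (simp add: opp_emb_entry s_def x_def)
      have val: "T $$ (i,j) = T $$ (idx s y (cl i), idx s y (cl j))"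
        if "y < 4" "s = 1 \<Longrightarrow> (x = 0) = (y = 0)" for y
      proof (cases "kind s (cl i) = kind s (cl j)")
        case True
        then show ?thesis using move[OF sx that(1) _ _ True that(2)] ie by simp
      next
        case False
        then have "T $$ (i,j) = 0" "T $$ (idx s y (cl i), idx s y (cl j)) = 0"
          using zero[OF ij] zero[of "idx s y (cl i)" "idx s y (cl j)"] that sx ie True s_def by auto
        then show ?thesis by simp
      qed
      show ?thesis
        unfolding rhs using val[of 0] val[of 1] sx by (auto simp: slot_def less_two)
    qed
  qed (use cT in \<open>auto simp: opp_def Jconj_def\<close>)
  ultimately show ?thesis by (intro exI[of _ ?f] exI[of _ ?g] exI[of _ ?h]) auto
qed

text \<open>Conditions (i) and (ii) make \<open>cliff a b\<close> contain every block-diagonal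
  operator with split third component. Then \<open>commutant_full\<close> gives one inclusion and
  \<open>opp_emb_commute\<close> the other.\<close>

lemma Hodge_sufficient:
  assumes c: "a \<in> carrier_mat 2 2" "b \<in> carrier_mat 2 2"
    and rows: "no_zero_rows a" "no_zero_rows b"
    and np: "\<not> (\<exists>\<phi> \<psi>. a = diag_phase \<phi> \<psi> * b)"
  shows "commutant (cliff a b) = opp ` cliff a b"
proof -
  obtain s t where "s \<noteq> t" "unit2 s t 2 2 \<in> cliff a b" using cliff_separates[OF c np] by blast
  note corner = cliff_corner[OF this]
  have row: "\<exists>j\<in>{2,3}. Xmat x $$ (i,j) \<noteq> 0" if "no_zero_rows x" "x \<in> carrier_mat 2 2" "i < 2" for x i
  proof -
    have "dim_row x = 2" "dim_col x = 2" using that(2) by auto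
    then obtain j where j: "j < 2" "x $$ (i,j) \<noteq> 0"
      using \<open>no_zero_rows x\<close> \<open>i < 2\<close> unfolding no_zero_rows_def by metis
    then have "Xmat x $$ (i, j + 2) \<noteq> 0" using that(3) by (simp add: Xmat_def)
    moreover have "j + 2 \<in> {2,3}" using j(1) by auto
    ultimately show ?thesis by blast
  qed
  have full: "emb f g h \<in> cliff a b"
    if "f \<in> carrier_mat 4 4" "g \<in> carrier_mat 4 4" "h \<in> carrier_mat 4 4" "split1 h" for f g h
  proof (rule cliff_full[OF _ _ that])
    show "unit2 1 0 k l \<in> cliff a b" if "k < 4" "l < 4" for k l
      using that row[OF rows(1) c(1)] by (intro cliff_unit2[OF corner(1)]) auto
    show "unit2 0 1 k l \<in> cliff a b" if "k < 4" "l < 4" for k l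
      using that row[OF rows(2) c(2)] by (intro cliff_unit2[OF corner(2)]) auto
  qed
  have elem: "\<exists>f g h. x = emb f g h \<and> split1 h" if "x \<in> cliff a b" for x
  proof -
    have "x \<in> intertw_alg (\<lambda>_. 0) 0 0"
      using cliff_subset_intertw_alg[of "\<lambda>_. 0" 0 a b 0] that by (auto simp: intertw_def)
    then show ?thesis unfolding intertw_alg_def by blast
  qed
  show ?thesis
  proof
    show "commutant (cliff a b) \<subseteq> opp ` cliff a b"
      using commutant_full[of "cliff a b", OF full] full by blast
    show "opp ` cliff a b \<subseteq> commutant (cliff a b)"
    proof
      fix T assume "T \<in> opp ` cliff a b"
      then obtain f g h where T: "T = opp (emb f g h)" "split1 h" using elem by blast
      have "T * y = y * T" if "y \<in> cliff a b" for y
        using elem[OF that] opp_emb_commute[OF T(2)] unfolding T(1) by blast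
      then show "T \<in> commutant (cliff a b)" by (simp add: commutant_def T(1))
    qed
  qed
qed

theorem theorem15:
  fixes a13 a14 a23 a24 b13 b14 b23 b24 d12 d13 d14 d21 d22 d23 d24 Ups :: complex
  assumes "d12 = 0" "d13 = 0" "d14 = 0" "d21 = 0" "d22 = 0" "d23 = 0" "d24 = 0"
  shows "Hodge (Dirac (mat2 a13 a14 a23 a24) (mat2 b13 b14 b23 b24)
                      (Ymat d12 d13 d14 d21 d22 d23 d24) Ups)
         \<longleftrightarrow> (no_zero_rows (mat2 a13 a14 a23 a24) \<and> no_zero_rows (mat2 b13 b14 b23 b24))
             \<and> \<not> (\<exists>\<phi> \<psi> :: real. mat2 a13 a14 a23 a24 = diag_phase \<phi> \<psi> * mat2 b13 b14 b23 b24)"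
proof -
  let ?a = "mat2 a13 a14 a23 a24" and ?b = "mat2 b13 b14 b23 b24"
  have "?a \<in> carrier_mat 2 2" "?b \<in> carrier_mat 2 2" by (simp_all add: mat2_def)
  note suff = Hodge_sufficient[OF this]
  show ?thesis
    unfolding assms Hodge_def CliffD_eq
  proof
    assume "commutant (cliff ?a ?b) = opp ` cliff ?a ?b"
    from Hodge_necessary[OF this] show "(no_zero_rows ?a \<and> no_zero_rows ?b) \<and> \<not> (\<exists>\<phi> \<psi>. ?a = diag_phase \<phi> \<psi> * ?b)"
      by simp
  next
    assume "(no_zero_rows ?a \<and> no_zero_rows ?b) \<and> \<not> (\<exists>\<phi> \<psi>. ?a = diag_phase \<phi> \<psi> * ?b)"
    then show "commutant (cliff ?a ?b) = opp ` cliff ?a ?b" by (intro suff) auto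
  qed
qed

end
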